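(* Let $\mu_1,\mu_2\in\mathcal{P}_1(\Theta)$ and $\Phi\in L^0(\Theta,\mathbb{R})$ be such that $(\mu_i)_\Phi\in\mathcal{P}_1(\Theta)$ for $i=1,2$. Then there exists a $1$-Lipschitz function $g_{\mathrm{opt}}$ on $\Theta$ such that $$\mathrm{W}_1(\mu_1,\mu_2)=Z_{\Phi,\mu_1}\left|\int g_{\mathrm{opt}}\,e^{\Phi}\,\mathrm{d}(\mu_1)_\Phi-\int g_{\mathrm{opt}}\,e^{\Phi}\,\mathrm{d}(\mu_2)_\Phi+\int g_{\mathrm{opt}}\,\mathrm{d}\mu_2\left(\frac{1}{Z_{\Phi,\mu_2}}-\frac{1}{Z_{\Phi,\mu_1}}\right)\right|.$$ In particular, if $Z_{\Phi,\mu_1}=Z_{\Phi,\mu_2}$, then $$\mathrm{W}_1(\mu_1,\mu_2)\leq Z_{\Phi,\mu_1}\,\Vert g_{\mathrm{opt}}e^{\Phi}\Vert_{\mathrm{Lip}(\operatorname{supp}(\mu_1+\mu_2),d)}\,\mathrm{W}_1((\mu_1)_\Phi,(\mu_2)_\Phi),$$ where equality holds if $\Vert g_{\mathrm{opt}}e^{\Phi}\Vert_{\mathrm{Lip}(\operatorname{supp}(\mu_1+\mu_2),d)}=0$.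
   Context: $(\Theta,d)$ is a Polish space with metric $d$ and Borel $\sigma$-algebra; $\mathcal{P}(\Theta)$ is the set of Borel probability measures on it. $L^0(\Theta,\mathbb{R})$ is the set of measurable functions $\Theta\to\mathbb{R}$. For $\Phi\in L^0(\Theta,\mathbb{R})$ and $\mu\in\mathcal{P}(\Theta)$: $Z_{\Phi,\mu}:=\int e^{-\Phi}\,\mathrm{d}\mu$; if $0<Z_{\Phi,\mu}<\infty$, then $\mu_\Phi$ is the probability measure with $\frac{\mathrm{d}\mu_\Phi}{\mathrm{d}\mu}=e^{-\Phi}/Z_{\Phi,\mu}$ (a requirement such as $\mu_\Phi\in\mathcal{P}_1(\Theta)$ includes $0<Z_{\Phi,\mu}<\infty$). $\mathcal{P}_1(\Theta)$ is the set of $\mu\in\mathcal{P}(\Theta)$ with $\int d(x_0,x)\,\mu(\mathrm{d}x)<\infty$ for some (equivalently, any) $x_0\in\Theta$. $\mathrm{W}_1(\mu,\nu):=\inf_{\pi\in\Pi(\mu,\nu)}\int d(x,y)\,\mathrm{d}\pi(x,y)$, where $\Pi(\mu,\nu)$ is the set of couplings of $\mu$ and $\nu$. $\operatorname{supp}\mu$ is the support of $\mu$. For $M\subset\Theta$ and $f:\Theta\to\mathbb{R}$, $\Vert f\Vert_{\mathrm{Lip}(M,d)}:=\sup_{x\neq y\in M}\frac{|f(x)-f(y)|}{d(x,y)}\in[0,\infty]$; $f$ is $1$-Lipschitz on $M$ if this is at most $1$. *)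

theory Defs
  imports "HOL-Probability.Probability"
begin

definition borel_probs :: "'a::topological_space measure set" where
  "borel_probs = {\<mu>. prob_space \<mu> \<and> sets \<mu> = sets borel}"

definition borel_probs1 :: "'a::metric_space measure set" where
  "borel_probs1 = {\<mu> \<in> borel_probs. \<exists>x0. (\<integral>\<^sup>+ x. ennreal (dist x0 x) \<partial>\<mu>) < \<infinity>}"

definition couplings ::
    "'a::topological_space measure \<Rightarrow> 'a measure \<Rightarrow> ('a \<times> 'a) measure set" where
  "couplings \<mu> \<nu> = {\<pi> \<in> borel_probs. distr \<pi> borel fst = \<mu> \<and> distr \<pi> borel snd = \<nu>}"

definition W1 :: "'a::metric_space measure \<Rightarrow> 'a measure \<Rightarrow> ennreal" where
  "W1 \<mu> \<nu> = (INF \<pi>\<in>couplings \<mu> \<nu>. \<integral>\<^sup>+ p. ennreal (dist (fst p) (snd p)) \<partial>\<pi>)"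

definition partition_fn :: "('a \<Rightarrow> real) \<Rightarrow> 'a measure \<Rightarrow> ennreal" where
  "partition_fn \<Phi> \<mu> = (\<integral>\<^sup>+ x. ennreal (exp (- \<Phi> x)) \<partial>\<mu>)"

text \<open>The tilted measure \<open>\<mu>\<^sub>\<Phi>\<close>; meaningful only if \<open>0 < partition_fn \<Phi> \<mu> < \<infinity>\<close>.\<close>

definition tilt :: "('a \<Rightarrow> real) \<Rightarrow> 'a measure \<Rightarrow> 'a measure" where
  "tilt \<Phi> \<mu> = density \<mu> (\<lambda>x. ennreal (exp (- \<Phi> x)) / partition_fn \<Phi> \<mu>)"

definition supp :: "'a::topological_space measure \<Rightarrow> 'a set" where
  "supp \<mu> = {x. \<forall>U. open U \<and> x \<in> U \<longrightarrow> 0 < emeasure \<mu> U}"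

definition add_measure :: "'a measure \<Rightarrow> 'a measure \<Rightarrow> 'a measure" where
  "add_measure \<mu> \<nu> =
     measure_of (space \<mu>) (sets \<mu>) (\<lambda>A. emeasure \<mu> A + emeasure \<nu> A)"

lemma sets_add_measure [simp]: "sets (add_measure \<mu> \<nu>) = sets \<mu>"
  by (simp add: add_measure_def)

lemma space_add_measure [simp]: "space (add_measure \<mu> \<nu>) = space \<mu>"
  by (simp add: add_measure_def)

lemma emeasure_add_measure:
  assumes "sets \<mu> = sets \<nu>" "A \<in> sets \<mu>"
  shows "emeasure (add_measure \<mu> \<nu>) A = emeasure \<mu> A + emeasure \<nu> A"
proof (rule emeasure_measure_of[OF add_measure_def])
  show "countably_additive (sets (add_measure \<mu> \<nu>)) (\<lambda>A. emeasure \<mu> A + emeasure \<nu> A)"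
  proof (rule countably_additiveI)
    fix F :: "nat \<Rightarrow> 'a set"
    assume F: "range F \<subseteq> sets (add_measure \<mu> \<nu>)" "disjoint_family F"
    then have "(\<Sum>i. emeasure \<mu> (F i) + emeasure \<nu> (F i))
        = (\<Sum>i. emeasure \<mu> (F i)) + (\<Sum>i. emeasure \<nu> (F i))"
      by (intro suminf_add[symmetric]) auto
    with F show "(\<Sum>i. emeasure \<mu> (F i) + emeasure \<nu> (F i))
        = emeasure \<mu> (\<Union>i. F i) + emeasure \<nu> (\<Union>i. F i)"
      using assms(1) by (simp add: suminf_emeasure)
  qed
qed (use assms sets.space_closed[of \<mu>] in \<open>auto simp: positive_def\<close>)

text \<open>The supremum over an empty set of pairs is \<open>0\<close>.\<close>

definition lip_norm :: "'a::metric_space set \<Rightarrow> ('a \<Rightarrow> real) \<Rightarrow> ennreal" where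
  "lip_norm M f =
     (SUP (x, y) \<in> {(x, y). x \<in> M \<and> y \<in> M \<and> x \<noteq> y}. ennreal (\<bar>f x - f y\<bar> / dist x y))"

end

(* With g a maximiser in the Kantorovich-Rubinstein duality for (mu_1, mu_2), the first identity is
   algebra, because tilting turns the integral of g e^Phi against (mu_i)_Phi into that of g against
   mu_i divided by the partition function. For equal partition functions the bound integrates the
   Lipschitz estimate of g e^Phi against couplings of the tilted measures, which live on the support
   of mu_1 + mu_2; if the Lipschitz norm is infinite it says something only when the tilted measures
   have distance 0, and then mu_1 = mu_2.

   The duality is obtained by discretisation. For finitely supported marginals it follows from a
   finite-dimensional Hahn-Banach argument. An approximation of the identity by maps T of finite range
   reduces the general case to this one: a coupling of the images under T lifts to a coupling of the
   original measures at the additional cost of moving points by T. The potentials obtained are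
   1-Lipschitz, and normalised to vanish at a point they converge pointwise along a subsequence; by
   dominated convergence the limit is a maximiser. *)

theory Submission
  imports Defs "HOL-Complex_Analysis.Great_Picard"
begin

subsection \<open>Finite Kantorovich duality\<close>

text \<open>Homogeneity is demanded as an inequality for positive factors; the same inequality for
  the reciprocal factor turns it into an equality in \<open>sublinear_scale\<close>.\<close>

definition sublinear :: "(('b \<Rightarrow> real) \<Rightarrow> real) \<Rightarrow> bool" where
  "sublinear N \<longleftrightarrow> (\<forall>f g. N (\<lambda>i. f i + g i) \<le> N f + N g)
     \<and> (\<forall>c f. 0 < c \<longrightarrow> N (\<lambda>i. c * f i) \<le> c * N f)"

lemma sublinear_add: "sublinear N \<Longrightarrow> N (\<lambda>i. f i + g i) \<le> N f + N g"
  by (simp add: sublinear_def)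

lemma sublinear_scale:
  assumes "sublinear N" "0 < c"
  shows "N (\<lambda>i. c * f i) = c * N f"
proof (rule antisym)
  show "N (\<lambda>i. c * f i) \<le> c * N f"
    using assms by (simp add: sublinear_def)
  have "N (\<lambda>i. (1 / c) * (c * f i)) \<le> (1 / c) * N (\<lambda>i. c * f i)"
    using assms unfolding sublinear_def by (meson zero_less_divide_1_iff)
  with assms(2) show "c * N f \<le> N (\<lambda>i. c * f i)"
    by (simp add: field_simps)
qed

lemma sublinear_zero: "sublinear N \<Longrightarrow> N (\<lambda>i. 0) = 0"
  using sublinear_scale[of N 2 "\<lambda>i. 0"] by simp

lemma sublinear_uminus:
  assumes "sublinear N"
  shows "- N f \<le> N (\<lambda>i. - f i)"
  using sublinear_add[OF assms, of f "\<lambda>i. - f i"] sublinear_zero[OF assms] by simp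

text \<open>The step of the Hahn-Banach argument, with \<open>N' x = inf\<^bsub>t \<ge> 0\<^esub> N (x + t v) - t N v\<close>: the functional
  remains sublinear, which saves extending linear functionals from subspaces.\<close>

lemma sublinear_flatten:
  fixes v :: "'b \<Rightarrow> real"
  assumes N: "sublinear N"
  obtains N' where "sublinear N'" "\<And>f. N' f \<le> N f" "N' (\<lambda>i. - v i) \<le> - N v"
proof
  define G where "G x t = N (\<lambda>i. x i + t * v i) - t * N v" for x t
  define N' where "N' x = (INF t\<in>{0..}. G x t)" for x
  \<comment> \<open>Subadditivity applied to \<open>x + t v\<close> and \<open>- x\<close> gives
    \<open>t * N v \<le> N (x + t v) + N (- x)\<close>, a lower bound for \<open>G x t\<close> that
    is uniform in \<open>t\<close>.\<close>
  have bdd: "bdd_below (G x ` {0..})" for x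
  proof (rule bdd_belowI2)
    fix t :: real assume "t \<in> {0..}"
    then have "t * N v = N (\<lambda>i. t * v i)"
      using sublinear_scale[OF N] sublinear_zero[OF N] by (cases "t = 0") auto
    then show "- N (\<lambda>i. - x i) \<le> G x t"
      using sublinear_add[OF N, of "\<lambda>i. x i + t * v i" "\<lambda>i. - x i"] by (simp add: G_def)
  qed
  have le: "N' x \<le> G x t" if "0 \<le> t" for x t
    unfolding N'_def using that by (intro cINF_lower bdd) auto
  have ge: "a \<le> N' x" if "\<And>t. 0 \<le> t \<Longrightarrow> a \<le> G x t" for a x
    unfolding N'_def using that by (intro cINF_greatest) auto
  show "N' f \<le> N f" for f
    using le[of 0 f] by (simp add: G_def)
  \<comment> \<open>At \<open>t = 1\<close> the argument \<open>- v + v\<close> vanishes.\<close>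
  show "N' (\<lambda>i. - v i) \<le> - N v"
    using le[of 1 "\<lambda>i. - v i"] sublinear_zero[OF N] by (simp add: G_def)
  show "sublinear N'"
    unfolding sublinear_def
  proof (intro conjI allI impI)
    fix f g :: "'b \<Rightarrow> real"
    \<comment> \<open>The parameter \<open>t + s\<close> serves the sum; the infima over
      \<open>s\<close> and \<open>t\<close> are then taken one after the other.\<close>
    have "N' (\<lambda>i. f i + g i) - G f t \<le> G g s" if "0 \<le> t" "0 \<le> s" for t s
    proof -
      have "N' (\<lambda>i. f i + g i) \<le> G (\<lambda>i. f i + g i) (t + s)"
        using that by (intro le) auto
      also have "\<dots> \<le> G f t + G g s"
        using sublinear_add[OF N, of "\<lambda>i. f i + t * v i" "\<lambda>i. g i + s * v i"]
        by (simp add: G_def algebra_simps)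
      finally show ?thesis by simp
    qed
    then have "N' (\<lambda>i. f i + g i) - G f t \<le> N' g" if "0 \<le> t" for t
      using that by (intro ge) auto
    then have "N' (\<lambda>i. f i + g i) - N' g \<le> N' f"
      by (intro ge) (auto simp: algebra_simps)
    then show "N' (\<lambda>i. f i + g i) \<le> N' f + N' g" by simp
  next
    fix c :: real and f :: "'b \<Rightarrow> real" assume c: "0 < c"
    have "N' (\<lambda>i. c * f i) / c \<le> G f t" if "0 \<le> t" for t
    proof -
      have "N' (\<lambda>i. c * f i) \<le> G (\<lambda>i. c * f i) (c * t)"
        using that c by (intro le) auto
      also have "\<dots> = c * G f t"
        using sublinear_scale[OF N c, of "\<lambda>i. f i + t * v i"] by (simp add: G_def algebra_simps)
      finally show ?thesis using c by (simp add: field_simps)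
    qed
    then have "N' (\<lambda>i. c * f i) / c \<le> N' f" by (rule ge)
    then show "N' (\<lambda>i. c * f i) \<le> c * N' f" using c by (simp add: field_simps)
  qed
qed

text \<open>One flattening per direction. A direction \<open>w\<close> that is already flat stays
  flat when the functional decreases:
  \<open>N2 (- w) \<le> N1 (- w) \<le> - N1 w \<le> - N2 w\<close>.\<close>

lemma sublinear_flatten_finite:
  assumes N: "sublinear N" and B: "finite B"
  obtains N' where "sublinear N'" "\<And>f. N' f \<le> N f" "\<And>v. v \<in> B \<Longrightarrow> N' (\<lambda>i. - v i) \<le> - N' v"
  using B
proof (induction B arbitrary: thesis rule: finite_induct)
  case empty
  then show ?case using N by auto
next
  case (insert v B)
  obtain N1 where N1: "sublinear N1" "\<And>f. N1 f \<le> N f" "\<And>v. v \<in> B \<Longrightarrow> N1 (\<lambda>i. - v i) \<le> - N1 v"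
    using insert.IH by blast
  obtain N2 where N2: "sublinear N2" "\<And>f. N2 f \<le> N1 f" "N2 (\<lambda>i. - v i) \<le> - N1 v"
    using sublinear_flatten[OF N1(1)] by blast
  show ?case
  proof (rule insert.prems)
    show "N2 f \<le> N f" for f using N1(2) N2(2) order_trans by blast
    show "N2 (\<lambda>i. - w i) \<le> - N2 w" if "w \<in> insert v B" for w
      using that N1(3)[of w] N2(2)[of w] N2(2)[of "\<lambda>i. - w i"] N2(3) by fastforce
  qed fact
qed

text \<open>The hypothesis reverses \<open>sublinear_uminus\<close>, so \<open>N\<close> is odd
  along \<open>v\<close> and hence homogeneous there for all real factors. Subadditivity, used once
  to add \<open>t * v\<close> and once to remove it, then gives both inequalities.\<close>

lemma sublinear_linear_along:
  assumes N: "sublinear N" and v: "N (\<lambda>i. - v i) \<le> - N v"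
  shows "N (\<lambda>i. f i + t * v i) = N f + t * N v"
proof -
  have odd: "N (\<lambda>i. - v i) = - N v"
    using v sublinear_uminus[OF N, of v] by simp
  have hom: "N (\<lambda>i. s * v i) = s * N v" for s
  proof -
    consider "s = 0" | "0 < s" | "0 < - s" by linarith
    then show ?thesis
      using sublinear_zero[OF N] sublinear_scale[OF N, of s v]
        sublinear_scale[OF N, of "- s" "\<lambda>i. - v i"] odd by cases auto
  qed
  show ?thesis
    using sublinear_add[OF N, of f "\<lambda>i. t * v i"] hom[of t] hom[of "- t"]
      sublinear_add[OF N, of "\<lambda>i. f i + t * v i" "\<lambda>i. - t * v i"] by simp
qed

text \<open>Flatness along the unit vectors of a finite set makes \<open>N\<close> linear on
  functions supported there, so it is given by its values on points. These values become the entries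
  of a coupling.\<close>

lemma sublinear_sum_indicator:
  assumes N: "sublinear N" and "finite I"
    and "\<And>j. j \<in> I \<Longrightarrow> N (\<lambda>i. - indicator {j} i) \<le> - N (indicator {j})"
  shows "N (\<lambda>i. indicator I i * a i) = (\<Sum>j\<in>I. a j * N (indicator {j}))"
  using assms(2,3)
proof (induction I rule: finite_induct)
  case empty
  then show ?case using sublinear_zero[OF N] by simp
next
  case (insert j I)
  have "(\<lambda>i. indicator (insert j I) i * a i) = (\<lambda>i. indicator I i * a i + a j * indicator {j} i)"
    using insert.hyps by (auto simp: indicator_def)
  then show ?case
    using sublinear_linear_along[OF N, of "indicator {j}" "\<lambda>i. indicator I i * a i" "a j"] insert
    by simp
qed

section \<open>Duality for finitely supported marginals\<close>

text \<open>The least value of a pair of potentials whose sum dominates \<open>h\<close> is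
  sublinear in \<open>h\<close>. A functional \<open>L\<close> below it, flat along all unit vectors
  and extremal at the cost, is a coupling whose cost is at most the dual value.\<close>

lemma finite_kantorovich_duality:
  fixes p :: "'a \<Rightarrow> real" and q :: "'b \<Rightarrow> real" and c :: "'a \<Rightarrow> 'b \<Rightarrow> real"
  assumes S: "finite S" and T: "finite T"
    and p: "\<And>x. x \<in> S \<Longrightarrow> 0 \<le> p x" "sum p S = 1"
    and q: "\<And>y. y \<in> T \<Longrightarrow> 0 \<le> q y" "sum q T = 1"
    and e: "0 < e"
  obtains \<pi> \<phi> \<psi> where
    "\<And>x y. x \<in> S \<Longrightarrow> y \<in> T \<Longrightarrow> 0 \<le> \<pi> x y"
    "\<And>x. x \<in> S \<Longrightarrow> (\<Sum>y\<in>T. \<pi> x y) = p x"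
    "\<And>y. y \<in> T \<Longrightarrow> (\<Sum>x\<in>S. \<pi> x y) = q y"
    "\<And>x y. x \<in> S \<Longrightarrow> y \<in> T \<Longrightarrow> \<phi> x + \<psi> y \<le> c x y"
    "(\<Sum>x\<in>S. \<Sum>y\<in>T. c x y * \<pi> x y) < (\<Sum>x\<in>S. \<phi> x * p x) + (\<Sum>y\<in>T. \<psi> y * q y) + e"
proof -
  define val where "val \<phi> \<psi> = (\<Sum>x\<in>S. \<phi> x * p x) + (\<Sum>y\<in>T. \<psi> y * q y)" for \<phi> \<psi>
  define adm where "adm h \<phi> \<psi> \<longleftrightarrow> (\<forall>x\<in>S. \<forall>y\<in>T. h (x, y) \<le> \<phi> x + \<psi> y)"
    for h and \<phi> :: "'a \<Rightarrow> real" and \<psi> :: "'b \<Rightarrow> real"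
  define D where "D h = {val \<phi> \<psi> |\<phi> \<psi>. adm h \<phi> \<psi>}" for h
  \<comment> \<open>A linear functional below \<open>N\<close> is integration against a coupling.\<close>
  define N where "N h = Inf (D h)" for h
  \<comment> \<open>Weak duality against the product coupling \<open>p x * q y\<close>: every
    admissible value dominates the integral of \<open>h\<close>, because both total masses are
    1.\<close>
  have bdd: "bdd_below (D h)" for h
  proof (rule bdd_belowI)
    fix a assume "a \<in> D h"
    then obtain \<phi> \<psi> where a: "a = val \<phi> \<psi>" "adm h \<phi> \<psi>" by (auto simp: D_def)
    have "(\<Sum>x\<in>S. \<Sum>y\<in>T. p x * q y * h (x, y)) \<le> (\<Sum>x\<in>S. \<Sum>y\<in>T. p x * q y * (\<phi> x + \<psi> y))"
      using a(2) p q by (intro sum_mono mult_left_mono) (auto simp: adm_def)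
    also have "\<dots> = (\<Sum>x\<in>S. p x * \<phi> x * (\<Sum>y\<in>T. q y)) + (\<Sum>x\<in>S. p x) * (\<Sum>y\<in>T. q y * \<psi> y)"
      by (simp add: sum_distrib_left sum_distrib_right sum.distrib algebra_simps) (subst sum.swap, simp add: algebra_simps)
    also have "\<dots> = a"
      using p q by (simp add: a val_def mult.commute)
    finally show "(\<Sum>x\<in>S. \<Sum>y\<in>T. p x * q y * h (x, y)) \<le> a" .
  qed
  have le: "N h \<le> val \<phi> \<psi>" if "adm h \<phi> \<psi>" for h \<phi> \<psi>
    unfolding N_def using that bdd by (intro cInf_lower) (auto simp: D_def)
  have ne: "D h \<noteq> {}" for h
  proof -
    have "adm h (\<lambda>x. \<Sum>y\<in>T. \<bar>h (x, y)\<bar>) (\<lambda>y. 0)"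
      unfolding adm_def
    proof (intro ballI)
      fix x y assume "x \<in> S" "y \<in> T"
      then have "\<bar>h (x, y)\<bar> \<le> (\<Sum>y\<in>T. \<bar>h (x, y)\<bar>)"
        using T by (intro member_le_sum) auto
      then show "h (x, y) \<le> (\<Sum>y\<in>T. \<bar>h (x, y)\<bar>) + 0" by simp
    qed
    then show ?thesis by (auto simp: D_def)
  qed
  have ge: "a \<le> N h" if "\<And>\<phi> \<psi>. adm h \<phi> \<psi> \<Longrightarrow> a \<le> val \<phi> \<psi>" for a h
    unfolding N_def using that ne by (intro cInf_greatest) (auto simp: D_def)
  have N: "sublinear N"
    unfolding sublinear_def
  proof (intro conjI allI impI)
    fix f g
    have "N (\<lambda>i. f i + g i) - val \<phi> \<psi> \<le> val \<phi>' \<psi>'" if "adm f \<phi> \<psi>" "adm g \<phi>' \<psi>'" for \<phi> \<psi> \<phi>' \<psi>'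
    proof -
      have "adm (\<lambda>i. f i + g i) (\<lambda>x. \<phi> x + \<phi>' x) (\<lambda>y. \<psi> y + \<psi>' y)"
        using that unfolding adm_def by (smt (verit))
      from le[OF this] show ?thesis
        by (simp add: val_def algebra_simps sum.distrib)
    qed
    then have "N (\<lambda>i. f i + g i) - val \<phi> \<psi> \<le> N g" if "adm f \<phi> \<psi>" for \<phi> \<psi>
      using that by (intro ge)
    then have "N (\<lambda>i. f i + g i) - N g \<le> N f"
      by (intro ge) (auto simp: algebra_simps)
    then show "N (\<lambda>i. f i + g i) \<le> N f + N g" by simp
  next
    fix c :: real and f assume c: "0 < c"
    have "N (\<lambda>i. c * f i) / c \<le> val \<phi> \<psi>" if "adm f \<phi> \<psi>" for \<phi> \<psi>
    proof -
      have "adm (\<lambda>i. c * f i) (\<lambda>x. c * \<phi> x) (\<lambda>y. c * \<psi> y)"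
        using that c unfolding adm_def by (simp add: distrib_left[symmetric])
      from le[OF this] have "N (\<lambda>i. c * f i) \<le> c * val \<phi> \<psi>"
        by (simp add: val_def distrib_left sum_distrib_left mult.assoc)
      then show ?thesis using c by (simp add: field_simps)
    qed
    then have "N (\<lambda>i. c * f i) / c \<le> N f" by (rule ge)
    then show "N (\<lambda>i. c * f i) \<le> c * N f" using c by (simp add: field_simps)
  qed
  \<comment> \<open>With the negative cost, \<open>d \<le> \<phi> + \<psi>\<close> on
    \<open>S \<times> T\<close> says that \<open>- \<phi>\<close> and \<open>- \<psi>\<close> are
    feasible for \<open>c\<close>. The cutoff outside \<open>S \<times> T\<close> makes
    \<open>- d\<close> a finite sum of unit vectors, as \<open>Lsum\<close> requires.\<close>
  define d where "d i = - (indicator (S \<times> T) i * c (fst i) (snd i))" for i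
  \<comment> \<open>The direction \<open>d\<close> comes first: it secures
    \<open>N1 (- d) \<le> - N d\<close>, and the later flattenings only lower the functional, so
    \<open>L\<close> inherits the bound.\<close>
  obtain N1 where N1: "sublinear N1" "\<And>f. N1 f \<le> N f" "N1 (\<lambda>i. - d i) \<le> - N d"
    using sublinear_flatten[OF N] by blast
  obtain L where L: "sublinear L" "\<And>f. L f \<le> N1 f"
      "\<And>v. v \<in> (\<lambda>j. indicator {j}) ` (S \<times> T) \<Longrightarrow> L (\<lambda>i. - v i) \<le> - L v"
    using sublinear_flatten_finite[OF N1(1), of "(\<lambda>j. indicator {j}) ` (S \<times> T)"] S T by auto
  have LN: "L f \<le> N f" for f using L(2) N1(2) order_trans by blast
  have LN': "- L f \<le> N (\<lambda>i. - f i)" for f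
    using LN[of "\<lambda>i. - f i"] sublinear_uminus[OF L(1), of f] by linarith
  define \<pi> where "\<pi> x y = L (indicator {(x, y)})" for x y
  have Lsum: "L (\<lambda>i. indicator (S \<times> T) i * a i) = (\<Sum>x\<in>S. \<Sum>y\<in>T. a (x, y) * \<pi> x y)" for a
    using sublinear_sum_indicator[OF L(1), of "S \<times> T" a] L(3) S T
    by (simp add: sum.cartesian_product \<pi>_def split_beta)
  \<comment> \<open>The tolerance \<open>e\<close> pays for potentials that merely approach the
    infimum.\<close>
  have "N d < N d + e" using e by simp
  then have "\<exists>a\<in>D d. a < N d + e"
    unfolding N_def using bdd ne by (subst (asm) cInf_less_iff) auto
  then obtain \<phi> \<psi> where adm: "adm d \<phi> \<psi>" and val: "val \<phi> \<psi> < N d + e"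
    by (auto simp: D_def)
  show thesis
  proof (rule that[of \<pi> "\<lambda>x. - \<phi> x" "\<lambda>y. - \<psi> y"])
    fix x y assume xy: "x \<in> S" "y \<in> T"
    \<comment> \<open>Zero potentials dominate a negative indicator, so \<open>N\<close> is at most
      0 there and the entry of \<open>\<pi>\<close> is nonnegative.\<close>
    have "N (\<lambda>i. - indicator {(x, y)} i) \<le> val (\<lambda>x. 0) (\<lambda>y. 0)"
      by (rule le) (auto simp: adm_def indicator_def)
    then show "0 \<le> \<pi> x y"
      using LN'[of "indicator {(x, y)}"] by (simp add: val_def \<pi>_def)
    show "- \<phi> x + - \<psi> y \<le> c x y"
      using bspec[OF bspec[OF adm[unfolded adm_def] xy(1)] xy(2)] xy by (simp add: d_def)
  next
    fix x assume x: "x \<in> S"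
    \<comment> \<open>On \<open>S \<times> T\<close> this function depends on the first coordinate
      alone, so it and its negative are dominated by themselves as potentials. This squeezes
      \<open>L h\<close> between \<open>p x\<close> and \<open>p x\<close>.\<close>
    define h :: "'a \<times> 'b \<Rightarrow> real" where "h = (\<lambda>i. indicator (S \<times> T) i * indicator {x} (fst i))"
    have "N h \<le> val (indicator {x}) (\<lambda>y. 0)"
      by (rule le) (auto simp: adm_def indicator_def h_def)
    moreover have "N (\<lambda>i. - h i) \<le> val (\<lambda>i. - indicator {x} i) (\<lambda>y. 0)"
      by (rule le) (auto simp: adm_def indicator_def h_def)
    moreover have "(\<Sum>i\<in>S. indicator {x} i * p i) = p x"
      using S x by (simp add: indicator_def if_distrib[of "\<lambda>a. a * _"] sum.delta cong: if_cong)
    ultimately have "L h = p x"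
      using LN[of h] LN'[of h] by (simp add: val_def sum_negf)
    moreover have "L h = (\<Sum>y\<in>T. \<pi> x y)"
      unfolding h_def Lsum using S x
      by (simp add: indicator_def if_distrib[of "\<lambda>a. a * _"] sum.If_cases sum.delta flip: sum_distrib_left cong: if_cong)
    ultimately show "(\<Sum>y\<in>T. \<pi> x y) = p x" by simp
  next
    fix y assume y: "y \<in> T"
    define h :: "'a \<times> 'b \<Rightarrow> real" where "h = (\<lambda>i. indicator (S \<times> T) i * indicator {y} (snd i))"
    have "N h \<le> val (\<lambda>x. 0) (indicator {y})"
      by (rule le) (auto simp: adm_def indicator_def h_def)
    moreover have "N (\<lambda>i. - h i) \<le> val (\<lambda>x. 0) (\<lambda>i. - indicator {y} i)"
      by (rule le) (auto simp: adm_def indicator_def h_def)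
    moreover have "(\<Sum>i\<in>T. indicator {y} i * q i) = q y"
      using T y by (simp add: indicator_def if_distrib[of "\<lambda>a. a * _"] sum.delta cong: if_cong)
    ultimately have "L h = q y"
      using LN[of h] LN'[of h] by (simp add: val_def sum_negf)
    moreover have "L h = (\<Sum>x\<in>S. \<pi> x y)"
      unfolding h_def Lsum using T y
      by (simp add: indicator_def if_distrib[of "\<lambda>a. a * _"] sum.delta cong: if_cong)
    ultimately show "(\<Sum>x\<in>S. \<pi> x y) = q y" by simp
  next
    have "(\<Sum>x\<in>S. \<Sum>y\<in>T. c x y * \<pi> x y) = L (\<lambda>i. - d i)"
      using Lsum[of "\<lambda>i. c (fst i) (snd i)"] by (simp add: d_def)
    also have "\<dots> \<le> - N d" using L(2) N1(3) order_trans by blast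
    also have "\<dots> < - val \<phi> \<psi> + e" using val by simp
    finally show "(\<Sum>x\<in>S. \<Sum>y\<in>T. c x y * \<pi> x y)
        < (\<Sum>x\<in>S. - \<phi> x * p x) + (\<Sum>y\<in>T. - \<psi> y * q y) + e"
      by (simp add: val_def sum_negf)
  qed
qed

subsection \<open>Couplings and Lipschitz functions\<close>

lemma lip_norm_le_iff:
  fixes f :: "'a::metric_space \<Rightarrow> real"
  assumes "0 \<le> L"
  shows "lip_norm M f \<le> ennreal L \<longleftrightarrow> L-lipschitz_on M f"
proof -
  have *: "ennreal (\<bar>f x - f y\<bar> / dist x y) \<le> ennreal L \<longleftrightarrow> dist (f x) (f y) \<le> L * dist x y"
    if "x \<noteq> y" for x y
    using that assms by (simp add: ennreal_le_iff dist_real_def divide_le_eq)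
  show ?thesis
    unfolding lip_norm_def SUP_le_iff lipschitz_on_def using assms *
    by (auto; metis dist_self mult_zero_right order_refl)
qed

lemma lipschitz_on_UNIV_borel_measurable:
  fixes f :: "'a::metric_space \<Rightarrow> real"
  shows "L-lipschitz_on UNIV f \<Longrightarrow> f \<in> borel_measurable borel"
  by (intro borel_measurable_continuous_onI lipschitz_on_continuous_on)

lemma borel_probsD:
  assumes "\<mu> \<in> borel_probs"
  shows "prob_space \<mu>" "sets \<mu> = sets borel" "space \<mu> = UNIV"
  using assms sets_eq_imp_space_eq[of \<mu> borel] by (auto simp: borel_probs_def)

lemma borel_probs1_borel_probs: "\<mu> \<in> borel_probs1 \<Longrightarrow> \<mu> \<in> borel_probs"
  by (simp add: borel_probs1_def)

text \<open>A Lipschitz function grows at most linearly in the distance from \<open>x0\<close>,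
  which has finite mean.\<close>

lemma borel_probs1_lipschitz_integrable:
  fixes \<mu> :: "'a::metric_space measure" and f :: "'a \<Rightarrow> real"
  assumes \<mu>: "\<mu> \<in> borel_probs1" and f: "L-lipschitz_on UNIV f"
  shows "integrable \<mu> f"
proof -
  note [simp, measurable_cong] = borel_probsD(2)[OF borel_probs1_borel_probs[OF \<mu>]]
  interpret prob_space \<mu> using borel_probsD[OF borel_probs1_borel_probs[OF \<mu>]] by simp
  obtain x0 where x0: "(\<integral>\<^sup>+ x. ennreal (dist x0 x) \<partial>\<mu>) < \<infinity>"
    using \<mu> by (auto simp: borel_probs1_def)
  have [measurable]: "dist x0 \<in> borel_measurable borel"
    by (intro borel_measurable_continuous_onI continuous_intros)
  have "integrable \<mu> (dist x0)"
    using x0 by (subst integrable_iff_bounded) auto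
  then have "integrable \<mu> (\<lambda>x. \<bar>f x0\<bar> + L * dist x0 x)" by simp
  then show ?thesis
  proof (rule Bochner_Integration.integrable_bound)
    show "f \<in> borel_measurable \<mu>"
      using lipschitz_on_UNIV_borel_measurable[OF f] by simp
    have "\<bar>f x\<bar> \<le> \<bar>f x0\<bar> + L * dist x0 x" for x
      using lipschitz_onD[OF f, of x0 x] by (simp add: dist_real_def)
    then show "AE x in \<mu>. norm (f x) \<le> norm (\<bar>f x0\<bar> + L * dist x0 x)"
      by (intro AE_I2) (simp add: order_trans[OF _ abs_ge_self])
  qed
qed

text \<open>Frees the moment condition from its particular base point, since every distance function
  is 1-Lipschitz.\<close>

lemma borel_probs1_dist_integrable:
  fixes \<mu> :: "'a::metric_space measure"
  assumes \<mu>: "\<mu> \<in> borel_probs1"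
  shows "integrable \<mu> (dist z)"
proof (rule borel_probs1_lipschitz_integrable[OF \<mu>, of 1])
  have "\<bar>dist z x - dist z y\<bar> \<le> dist x y" for x y
    using abs_dist_diff_le[of x z y] by (simp add: dist_commute)
  then show "1-lipschitz_on UNIV (dist z)"
    by (simp add: lipschitz_on_def dist_real_def)
qed

section \<open>Couplings and the easy inequality of the duality\<close>

lemma couplingsD:
  assumes "\<pi> \<in> couplings \<mu> \<nu>"
  shows "prob_space \<pi>" "sets \<pi> = sets borel" "distr \<pi> borel fst = \<mu>" "distr \<pi> borel snd = \<nu>"
  using assms by (auto simp: couplings_def borel_probs_def)

lemma measurable_dist_fst_snd [measurable]:
  "(\<lambda>p. dist (fst p) (snd p)) \<in> borel_measurable (borel :: ('a::metric_space \<times> 'a) measure)"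
  by (intro borel_measurable_continuous_onI continuous_intros)

lemma couplings_measurable:
  assumes "\<pi> \<in> couplings \<mu> \<nu>"
  shows "fst \<in> measurable \<pi> borel" "snd \<in> measurable \<pi> borel"
  using couplingsD(2)[OF assms]
  by (auto cong: measurable_cong_sets intro!: borel_measurable_continuous_onI continuous_intros)

text \<open>The estimate \<open>\<bar>f x - f y\<bar> \<le> L * dist x y\<close> is integrated
  against the coupling. A Lipschitz condition on \<open>M\<close> suffices because both coordinates
  lie in \<open>M\<close> almost surely, as their marginals do.\<close>

lemma coupling_lipschitz_bound:
  fixes f :: "'a::metric_space \<Rightarrow> real"
  assumes \<pi>: "\<pi> \<in> couplings \<mu> \<nu>" and f: "L-lipschitz_on M f"
    and int: "integrable \<mu> f" "integrable \<nu> f"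
    and M: "AE x in \<mu>. x \<in> M" "AE x in \<nu>. x \<in> M"
  shows "ennreal \<bar>(\<integral>x. f x \<partial>\<mu>) - (\<integral>x. f x \<partial>\<nu>)\<bar>
    \<le> ennreal L * (\<integral>\<^sup>+ p. ennreal (dist (fst p) (snd p)) \<partial>\<pi>)"
proof -
  interpret prob_space \<pi> using couplingsD[OF \<pi>] by simp
  note [simp, measurable_cong] = couplingsD(2)[OF \<pi>]
  note [measurable] = couplings_measurable[OF \<pi>]
  note mu = couplingsD(3)[OF \<pi>, symmetric] and nu = couplingsD(4)[OF \<pi>, symmetric]
  have L: "0 \<le> L" using f lipschitz_on_nonneg by blast
  have fb [measurable]: "f \<in> borel_measurable borel"
    using borel_measurable_integrable[OF int(1)] by (simp add: mu)
  have i1: "integrable \<pi> (\<lambda>p. f (fst p))" and i2: "integrable \<pi> (\<lambda>p. f (snd p))"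
    using int by (simp_all add: mu nu integrable_distr_eq)
  have AE1: "AE p in \<pi>. fst p \<in> M"
    by (rule AE_distrD[OF couplings_measurable(1)[OF \<pi>]]) (simp only: couplingsD(3)[OF \<pi>] M)
  have AE2: "AE p in \<pi>. snd p \<in> M"
    by (rule AE_distrD[OF couplings_measurable(2)[OF \<pi>]]) (simp only: couplingsD(4)[OF \<pi>] M)
  have "(\<integral>x. f x \<partial>\<mu>) - (\<integral>x. f x \<partial>\<nu>) = (\<integral>p. f (fst p) - f (snd p) \<partial>\<pi>)"
    using i1 i2 by (simp add: mu nu integral_distr)
  then have "ennreal \<bar>(\<integral>x. f x \<partial>\<mu>) - (\<integral>x. f x \<partial>\<nu>)\<bar> \<le> (\<integral>\<^sup>+ p. ennreal \<bar>f (fst p) - f (snd p)\<bar> \<partial>\<pi>)"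
    using integral_norm_bound_ennreal[of \<pi> "\<lambda>p. f (fst p) - f (snd p)"] i1 i2 by simp
  also have "\<dots> \<le> (\<integral>\<^sup>+ p. ennreal L * ennreal (dist (fst p) (snd p)) \<partial>\<pi>)"
  proof (rule nn_integral_mono_AE)
    show "AE p in \<pi>. ennreal \<bar>f (fst p) - f (snd p)\<bar> \<le> ennreal L * ennreal (dist (fst p) (snd p))"
      using AE1 AE2
    proof eventually_elim
      case (elim p)
      then show ?case
        using lipschitz_onD[OF f, of "fst p" "snd p"] L
        by (simp add: dist_real_def flip: ennreal_mult)
    qed
  qed
  also have "\<dots> = ennreal L * (\<integral>\<^sup>+ p. ennreal (dist (fst p) (snd p)) \<partial>\<pi>)"
    by (rule nn_integral_cmult) measurable
  finally show ?thesis .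
qed

text \<open>Second countability identifies the product of the Borel sigma-algebras with the Borel
  sigma-algebra of the product space.\<close>

lemma pair_measure_in_couplings:
  fixes \<mu> \<nu> :: "'a::second_countable_topology measure"
  assumes \<mu>: "\<mu> \<in> borel_probs" and \<nu>: "\<nu> \<in> borel_probs"
  shows "\<mu> \<Otimes>\<^sub>M \<nu> \<in> couplings \<mu> \<nu>"
proof -
  note [simp] = borel_probsD(2,3)[OF \<mu>] borel_probsD(2,3)[OF \<nu>]
  note [measurable_cong] = borel_probsD(2)[OF \<mu>] borel_probsD(2)[OF \<nu>]
  interpret M: prob_space \<mu> using borel_probsD[OF \<mu>] by simp
  interpret N: prob_space \<nu> using borel_probsD[OF \<nu>] by simp
  interpret P: pair_prob_space \<mu> \<nu> ..
  have sets: "sets (\<mu> \<Otimes>\<^sub>M \<nu>) = sets borel"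
    unfolding borel_prod[symmetric] by (intro sets_pair_measure_cong) auto
  have "distr (\<mu> \<Otimes>\<^sub>M \<nu>) borel fst = \<mu>"
  proof (rule measure_eqI)
    fix A assume "A \<in> sets (distr (\<mu> \<Otimes>\<^sub>M \<nu>) borel fst)"
    then have A: "A \<in> sets borel" by simp
    then have "emeasure (distr (\<mu> \<Otimes>\<^sub>M \<nu>) borel fst) A = emeasure (\<mu> \<Otimes>\<^sub>M \<nu>) (A \<times> UNIV)"
      by (subst emeasure_distr) (auto intro!: arg_cong[where f="emeasure _"] simp: space_pair_measure)
    then show "emeasure (distr (\<mu> \<Otimes>\<^sub>M \<nu>) borel fst) A = emeasure \<mu> A"
      using A N.emeasure_space_1 by (simp add: N.emeasure_pair_measure_Times)
  qed simp
  moreover have "distr (\<mu> \<Otimes>\<^sub>M \<nu>) borel snd = \<nu>"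
  proof (rule measure_eqI)
    fix A assume "A \<in> sets (distr (\<mu> \<Otimes>\<^sub>M \<nu>) borel snd)"
    then have A: "A \<in> sets borel" by simp
    then have "emeasure (distr (\<mu> \<Otimes>\<^sub>M \<nu>) borel snd) A = emeasure (\<mu> \<Otimes>\<^sub>M \<nu>) (UNIV \<times> A)"
      by (subst emeasure_distr) (auto intro!: arg_cong[where f="emeasure _"] simp: space_pair_measure)
    then show "emeasure (distr (\<mu> \<Otimes>\<^sub>M \<nu>) borel snd) A = emeasure \<nu> A"
      using A M.emeasure_space_1 by (simp add: N.emeasure_pair_measure_Times)
  qed simp
  ultimately show ?thesis
    using sets P.prob_space_axioms by (simp add: couplings_def borel_probs_def)
qed

text \<open>For \<open>L > 0\<close> the bound for a single coupling is divided by \<open>L\<close>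
  and the infimum is taken. For \<open>L = 0\<close> one coupling is enough:
  \<open>0 * \<top> = 0\<close> forces the left side to vanish even if its cost is infinite.\<close>

lemma W1_lipschitz_bound:
  fixes \<mu> \<nu> :: "'a::{metric_space, second_countable_topology} measure" and f :: "'a \<Rightarrow> real"
  assumes \<mu>: "\<mu> \<in> borel_probs" and \<nu>: "\<nu> \<in> borel_probs" and f: "L-lipschitz_on M f"
    and int: "integrable \<mu> f" "integrable \<nu> f"
    and M: "AE x in \<mu>. x \<in> M" "AE x in \<nu>. x \<in> M"
  shows "ennreal \<bar>(\<integral>x. f x \<partial>\<mu>) - (\<integral>x. f x \<partial>\<nu>)\<bar> \<le> ennreal L * W1 \<mu> \<nu>"
proof (cases "L = 0")
  case True
  then show ?thesis
    using coupling_lipschitz_bound[OF pair_measure_in_couplings[OF \<mu> \<nu>] f int M] by simp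
next
  case False
  then have L: "0 < L" using lipschitz_on_nonneg[OF f] by simp
  have "ennreal \<bar>(\<integral>x. f x \<partial>\<mu>) - (\<integral>x. f x \<partial>\<nu>)\<bar> / ennreal L \<le> W1 \<mu> \<nu>"
    unfolding W1_def
  proof (rule INF_greatest)
    fix \<pi> assume "\<pi> \<in> couplings \<mu> \<nu>"
    from coupling_lipschitz_bound[OF this f int M]
    show "ennreal \<bar>(\<integral>x. f x \<partial>\<mu>) - (\<integral>x. f x \<partial>\<nu>)\<bar> / ennreal L
        \<le> (\<integral>\<^sup>+ p. ennreal (dist (fst p) (snd p)) \<partial>\<pi>)"
      using L by (intro divide_le_posI_ennreal) (auto simp: mult.commute)
  qed
  then have "ennreal L * (ennreal \<bar>(\<integral>x. f x \<partial>\<mu>) - (\<integral>x. f x \<partial>\<nu>)\<bar> / ennreal L) \<le> ennreal L * W1 \<mu> \<nu>"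
    by (rule mult_left_mono) simp
  then show ?thesis
    using L by (simp add: ennreal_times_divide ennreal_mult_divide_eq mult.commute divide_ennreal flip: ennreal_mult)
qed

subsection \<open>Lifting couplings from finite partitions\<close>

lemma nn_integral_finite_range:
  fixes f :: "'b \<Rightarrow> ennreal"
  assumes T: "simple_function M T"
  shows "(\<integral>\<^sup>+ x. f (T x) \<partial>M) = (\<Sum>s\<in>T ` space M. f s * emeasure M (T -` {s} \<inter> space M))"
proof -
  have fin: "finite (T ` space M)" and sets: "\<And>s. T -` {s} \<inter> space M \<in> sets M"
    using T by (auto simp: simple_functionD)
  have "(\<integral>\<^sup>+ x. f (T x) \<partial>M)
      = (\<integral>\<^sup>+ x. (\<Sum>s\<in>T ` space M. f s * indicator (T -` {s} \<inter> space M) x) \<partial>M)"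
  proof (rule nn_integral_cong)
    fix x assume x: "x \<in> space M"
    then have "(\<Sum>s\<in>T ` space M. f s * indicator (T -` {s} \<inter> space M) x)
        = (\<Sum>s\<in>T ` space M. if s = T x then f s else 0)"
      by (intro sum.cong) (auto simp: indicator_def)
    also have "\<dots> = f (T x)" using fin x by (simp add: sum.delta)
    finally show "f (T x) = (\<Sum>s\<in>T ` space M. f s * indicator (T -` {s} \<inter> space M) x)" by simp
  qed
  also have "\<dots> = (\<Sum>s\<in>T ` space M. f s * emeasure M (T -` {s} \<inter> space M))"
    using sets by (subst nn_integral_sum) (auto simp: nn_integral_cmult_indicator)
  finally show ?thesis .
qed

lemma (in prob_space) integral_finite_range:
  fixes f :: "'b \<Rightarrow> real"
  assumes T: "simple_function M T"
  shows "integrable M (\<lambda>x. f (T x))"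
    and "(\<integral>x. f (T x) \<partial>M) = (\<Sum>s\<in>T ` space M. f s * prob (T -` {s} \<inter> space M))"
proof -
  have fin: "finite (T ` space M)" and sets: "\<And>s. T -` {s} \<inter> space M \<in> sets M"
    using T by (auto simp: simple_functionD)
  have eq: "f (T x) = (\<Sum>s\<in>T ` space M. f s * indicator (T -` {s} \<inter> space M) x)"
    if x: "x \<in> space M" for x
  proof -
    have "(\<Sum>s\<in>T ` space M. f s * indicator (T -` {s} \<inter> space M) x)
        = (\<Sum>s\<in>T ` space M. if s = T x then f s else 0)"
      using x by (intro sum.cong) (auto simp: indicator_def)
    also have "\<dots> = f (T x)" using fin x by (simp add: sum.delta)
    finally show ?thesis by simp
  qed
  have int: "integrable M (\<lambda>x. f s * indicator (T -` {s} \<inter> space M) x)" for s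
    using sets by (intro integrable_mult_right) (simp add: integrable_indicator_iff emeasure_eq_measure)
  show "integrable M (\<lambda>x. f (T x))"
    by (subst Bochner_Integration.integrable_cong[OF refl eq]) (auto intro!: Bochner_Integration.integrable_sum int)
  show "(\<integral>x. f (T x) \<partial>M) = (\<Sum>s\<in>T ` space M. f s * prob (T -` {s} \<inter> space M))"
    using sets by (subst Bochner_Integration.integral_cong[OF refl eq]) (auto simp: Bochner_Integration.integral_sum[OF int])
qed

text \<open>There are finitely many fibres, so the null ones together form a null set. This
  justifies dividing by fibre masses almost everywhere.\<close>

lemma (in prob_space) AE_prob_fibre_pos:
  assumes T: "simple_function M T"
  shows "AE x in M. 0 < prob (T -` {T x} \<inter> space M)"
proof -
  have sets: "\<And>s. T -` {s} \<inter> space M \<in> sets M"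
    using T by (auto simp: simple_functionD)
  have "AE x in M. \<forall>s\<in>T ` space M. T x = s \<longrightarrow> 0 < prob (T -` {s} \<inter> space M)"
  proof (rule AE_finite_allI)
    show "finite (T ` space M)" using T by (simp add: simple_functionD)
    fix s assume "s \<in> T ` space M"
    show "AE x in M. T x = s \<longrightarrow> 0 < prob (T -` {s} \<inter> space M)"
    proof (cases "prob (T -` {s} \<inter> space M) = 0")
      case True
      then have "T -` {s} \<inter> space M \<in> null_sets M"
        using sets by (simp add: null_sets_def emeasure_eq_measure)
      then show ?thesis by (rule AE_I') auto
    next
      case False
      then show ?thesis by (simp add: zero_less_measure_iff)
    qed
  qed
  with AE_space show ?thesis by eventually_elim auto
qed

section \<open>From a coupling matrix to a coupling of measures\<close>

text \<open>The mass \<open>\<pi> s t\<close> is spread over the block of points labelled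
  \<open>s\<close> and \<open>t\<close> in proportion to the product measure. Inside a block the
  coordinates are independent, so the marginals come out right, and a cost that depends on the
  labels alone integrates to a sum over the matrix.\<close>

lemma block_coupling:
  fixes \<mu> \<nu> :: "'a::second_countable_topology measure" and T U :: "'a \<Rightarrow> 'b" and \<pi> :: "'b \<Rightarrow> 'b \<Rightarrow> real"
  assumes \<mu>: "\<mu> \<in> borel_probs" and \<nu>: "\<nu> \<in> borel_probs"
    and T: "simple_function borel T" and U: "simple_function borel U"
    and pos: "\<And>s t. s \<in> range T \<Longrightarrow> t \<in> range U \<Longrightarrow> 0 \<le> \<pi> s t"
    and row: "\<And>s. s \<in> range T \<Longrightarrow> (\<Sum>t\<in>range U. \<pi> s t) = measure \<mu> (T -` {s})"
    and col: "\<And>t. t \<in> range U \<Longrightarrow> (\<Sum>s\<in>range T. \<pi> s t) = measure \<nu> (U -` {t})"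
  obtains K where "K \<in> couplings \<mu> \<nu>"
    "\<And>h. (\<And>s t. 0 \<le> h s t) \<Longrightarrow> (\<integral>\<^sup>+ z. ennreal (h (T (fst z)) (U (snd z))) \<partial>K)
      = ennreal (\<Sum>s\<in>range T. \<Sum>t\<in>range U. h s t * \<pi> s t)"
proof -
  note [simp] = borel_probsD(2,3)[OF \<mu>] borel_probsD(2,3)[OF \<nu>]
  note [measurable_cong] = borel_probsD(2)[OF \<mu>] borel_probsD(2)[OF \<nu>]
  interpret M: prob_space \<mu> using borel_probsD[OF \<mu>] by simp
  interpret N: prob_space \<nu> using borel_probsD[OF \<nu>] by simp
  interpret P: pair_prob_space \<mu> \<nu> ..
  have T\<mu>: "simple_function \<mu> T" and U\<nu>: "simple_function \<nu> U"
    using T U by (auto simp: simple_function_def)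
  have fin: "finite (range T)" "finite (range U)"
    using T U by (auto simp: simple_function_def)
  have TU [measurable]: "T \<in> measurable borel (count_space UNIV)" "U \<in> measurable borel (count_space UNIV)"
    using T U measurable_simple_function by auto
  have sets: "sets (\<mu> \<Otimes>\<^sub>M \<nu>) = sets borel"
    unfolding borel_prod[symmetric] by (intro sets_pair_measure_cong) auto
  define p where "p s = measure \<mu> (T -` {s})" for s
  define q where "q t = measure \<nu> (U -` {t})" for t
  \<comment> \<open>If \<open>p s = 0\<close> or \<open>q t = 0\<close>, then \<open>\<pi> s t = 0\<close>, so the value of the quotient is irrelevant.\<close>
  define w where "w s t = \<pi> s t / (p s * q t)" for s t
  have w: "0 \<le> w s t" if "s \<in> range T" "t \<in> range U" for s t
    using pos[OF that] by (simp add: w_def p_def q_def)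
  have wTU: "0 \<le> w (T x) (U y)" for x y by (simp add: w)
  have \<pi>0: "\<pi> s t = 0" if st: "s \<in> range T" "t \<in> range U" and "p s = 0 \<or> q t = 0" for s t
  proof -
    have "\<pi> s t \<le> (\<Sum>t\<in>range U. \<pi> s t)"
      using fin pos st by (intro member_le_sum) auto
    moreover have "\<pi> s t \<le> (\<Sum>s\<in>range T. \<pi> s t)"
      using fin pos st by (intro member_le_sum[of s "range T" "\<lambda>s. \<pi> s t"]) auto
    ultimately show ?thesis
      using that(3) pos[OF st] row[OF st(1)] col[OF st(2)] by (auto simp: p_def q_def)
  qed
  have wpq: "w s t * q t * p s = \<pi> s t" if "s \<in> range T" "t \<in> range U" for s t
    using \<pi>0[OF that] by (auto simp: w_def)
  \<comment> \<open>The label type has no topology; measurability of an arbitrary function of two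
    labels comes from their finite ranges.\<close>
  have mw [measurable]: "(\<lambda>z. f (T (fst z)) (U (snd z))) \<in> borel_measurable (\<mu> \<Otimes>\<^sub>M \<nu>)"
    for f :: "'b \<Rightarrow> 'b \<Rightarrow> real"
  proof -
    have "simple_function (\<mu> \<Otimes>\<^sub>M \<nu>) (\<lambda>z. T (fst z))"
      unfolding simple_function_def
    proof (intro conjI ballI)
      show "finite ((\<lambda>z. T (fst z)) ` space (\<mu> \<Otimes>\<^sub>M \<nu>))"
        by (rule finite_subset[OF _ fin(1)]) auto
    qed measurable
    moreover have "simple_function (\<mu> \<Otimes>\<^sub>M \<nu>) (\<lambda>z. U (snd z))"
      unfolding simple_function_def
    proof (intro conjI ballI)
      show "finite ((\<lambda>z. U (snd z)) ` space (\<mu> \<Otimes>\<^sub>M \<nu>))"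
        by (rule finite_subset[OF _ fin(2)]) auto
    qed measurable
    ultimately have "simple_function (\<mu> \<Otimes>\<^sub>M \<nu>) (\<lambda>z. f (T (fst z)) (U (snd z)))"
      by (rule simple_function_compose2)
    then show ?thesis by (rule borel_measurable_simple_function)
  qed
  have mwT: "(\<lambda>x. ennreal (w (T x) t)) \<in> borel_measurable \<mu>" for t
    by (rule measurable_compose[where N = "count_space UNIV" and f = T]) measurable
  have mwU: "(\<lambda>y. ennreal (w s (U y))) \<in> borel_measurable \<nu>" for s
    by (rule measurable_compose[where N = "count_space UNIV" and f = U]) measurable
  define K where "K = density (\<mu> \<Otimes>\<^sub>M \<nu>) (\<lambda>z. ennreal (w (T (fst z)) (U (snd z))))"
  have setsP [simp]: "sets K = sets borel" by (simp only: K_def sets_density sets)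
  have spaceP [simp]: "space K = UNIV" using sets_eq_imp_space_eq[OF setsP] by simp
  \<comment> \<open>The section of the density over a point labelled \<open>s\<close> has mass 1:
    this is the row condition divided by \<open>p s\<close>.\<close>
  have rowmass: "(\<integral>\<^sup>+ y. ennreal (w s (U y)) \<partial>\<nu>) = 1" if "s \<in> range T" "0 < p s" for s
  proof -
    have "(\<integral>\<^sup>+ y. ennreal (w s (U y)) \<partial>\<nu>) = (\<Sum>t\<in>range U. ennreal (w s t * q t))"
      using nn_integral_finite_range[OF U\<nu>, of "\<lambda>t. ennreal (w s t)"] w that
      by (simp add: N.emeasure_eq_measure q_def ennreal_mult)
    also have "\<dots> = ennreal (\<Sum>t\<in>range U. w s t * q t)"
      using w that by (intro sum_ennreal) (simp add: q_def)
    also have "(\<Sum>t\<in>range U. w s t * q t) = (\<Sum>t\<in>range U. \<pi> s t) / p s"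
      unfolding sum_divide_distrib using that wpq[OF that(1)] by (intro sum.cong) (auto simp: field_simps)
    also have "\<dots> = 1" using row[OF that(1)] that(2) by (simp add: p_def)
    finally show ?thesis by simp
  qed
  have colmass: "(\<integral>\<^sup>+ x. ennreal (w (T x) t) \<partial>\<mu>) = 1" if "t \<in> range U" "0 < q t" for t
  proof -
    have "(\<integral>\<^sup>+ x. ennreal (w (T x) t) \<partial>\<mu>) = (\<Sum>s\<in>range T. ennreal (w s t * p s))"
      using nn_integral_finite_range[OF T\<mu>, of "\<lambda>s. ennreal (w s t)"] w that
      by (simp add: M.emeasure_eq_measure p_def ennreal_mult)
    also have "\<dots> = ennreal (\<Sum>s\<in>range T. w s t * p s)"
      using w that by (intro sum_ennreal) (simp add: p_def)
    also have "(\<Sum>s\<in>range T. w s t * p s) = (\<Sum>s\<in>range T. \<pi> s t) / q t"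
      unfolding sum_divide_distrib using that wpq[OF _ that(1)] by (intro sum.cong) (auto simp: field_simps)
    also have "\<dots> = 1" using col[OF that(1)] that(2) by (simp add: q_def)
    finally show ?thesis by simp
  qed
  have fst_eq: "distr K borel fst = \<mu>"
  proof (rule measure_eqI)
    fix A assume "A \<in> sets (distr K borel fst)"
    then have A [measurable]: "A \<in> sets borel" by simp
    then have mA: "fst -` A \<in> sets (\<mu> \<Otimes>\<^sub>M \<nu>)"
      using measurable_sets[of fst "\<mu> \<Otimes>\<^sub>M \<nu>" \<mu> A] by (simp add: space_pair_measure)
    have "emeasure (distr K borel fst) A = emeasure K (fst -` A)"
      using A by (subst emeasure_distr) (auto simp: K_def space_pair_measure)
    also have "\<dots> = (\<integral>\<^sup>+ z. ennreal (w (T (fst z)) (U (snd z))) * indicator (fst -` A) z \<partial>(\<mu> \<Otimes>\<^sub>M \<nu>))"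
      unfolding K_def by (rule emeasure_density[OF _ mA]) measurable
    also have "\<dots> = (\<integral>\<^sup>+ z. ennreal (w (T (fst z)) (U (snd z))) * indicator A (fst z) \<partial>(\<mu> \<Otimes>\<^sub>M \<nu>))"
      by (intro nn_integral_cong) (simp add: indicator_def)
    also have "\<dots> = (\<integral>\<^sup>+ x. (\<integral>\<^sup>+ y. ennreal (w (T x) (U y)) * indicator A x \<partial>\<nu>) \<partial>\<mu>)"
      by (subst N.nn_integral_fst[symmetric]) simp_all
    also have "\<dots> = (\<integral>\<^sup>+ x. indicator A x \<partial>\<mu>)"
    \<comment> \<open>Outside a null set the label of \<open>x\<close> has positive mass, and
      \<open>rowmass\<close> applies to it.\<close>
    proof (rule nn_integral_cong_AE)
      show "AE x in \<mu>. (\<integral>\<^sup>+ y. ennreal (w (T x) (U y)) * indicator A x \<partial>\<nu>) = indicator A x"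
        using M.AE_prob_fibre_pos[OF T\<mu>]
      proof eventually_elim
        case (elim x)
        then show ?case
          using rowmass[of "T x"] by (subst nn_integral_multc) (auto simp: p_def mwU)
      qed
    qed
    finally show "emeasure (distr K borel fst) A = emeasure \<mu> A" by simp
  qed simp
  have snd_eq: "distr K borel snd = \<nu>"
  proof (rule measure_eqI)
    fix A assume "A \<in> sets (distr K borel snd)"
    then have A [measurable]: "A \<in> sets borel" by simp
    then have mA: "snd -` A \<in> sets (\<mu> \<Otimes>\<^sub>M \<nu>)"
      using measurable_sets[of snd "\<mu> \<Otimes>\<^sub>M \<nu>" \<nu> A] by (simp add: space_pair_measure)
    have "emeasure (distr K borel snd) A = emeasure K (snd -` A)"
      using A by (subst emeasure_distr) (auto simp: K_def space_pair_measure)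
    also have "\<dots> = (\<integral>\<^sup>+ z. ennreal (w (T (fst z)) (U (snd z))) * indicator (snd -` A) z \<partial>(\<mu> \<Otimes>\<^sub>M \<nu>))"
      unfolding K_def by (rule emeasure_density[OF _ mA]) measurable
    also have "\<dots> = (\<integral>\<^sup>+ z. ennreal (w (T (fst z)) (U (snd z))) * indicator A (snd z) \<partial>(\<mu> \<Otimes>\<^sub>M \<nu>))"
      by (intro nn_integral_cong) (simp add: indicator_def)
    also have "\<dots> = (\<integral>\<^sup>+ y. (\<integral>\<^sup>+ x. ennreal (w (T x) (U y)) * indicator A y \<partial>\<mu>) \<partial>\<nu>)"
      by (subst P.nn_integral_snd[symmetric]) (simp_all add: split_beta)
    also have "\<dots> = (\<integral>\<^sup>+ y. indicator A y \<partial>\<nu>)"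
    proof (rule nn_integral_cong_AE)
      show "AE y in \<nu>. (\<integral>\<^sup>+ x. ennreal (w (T x) (U y)) * indicator A y \<partial>\<mu>) = indicator A y"
        using N.AE_prob_fibre_pos[OF U\<nu>]
      proof eventually_elim
        case (elim y)
        then show ?case
          using colmass[of "U y"] by (subst nn_integral_multc) (auto simp: q_def mwT)
      qed
    qed
    finally show "emeasure (distr K borel snd) A = emeasure \<nu> A" by simp
  qed simp
  have "emeasure K (space K) = emeasure (distr K borel fst) UNIV"
    by (subst emeasure_distr) (auto simp: K_def space_pair_measure)
  then have "prob_space K"
    using M.emeasure_space_1 by (intro prob_spaceI) (simp add: fst_eq)
  then have "K \<in> couplings \<mu> \<nu>"
    using fst_eq snd_eq by (simp add: couplings_def borel_probs_def)
  moreover have "(\<integral>\<^sup>+ z. ennreal (h (T (fst z)) (U (snd z))) \<partial>K)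
      = ennreal (\<Sum>s\<in>range T. \<Sum>t\<in>range U. h s t * \<pi> s t)" if h: "\<And>s t. 0 \<le> h s t" for h
  proof -
    have "(\<integral>\<^sup>+ z. ennreal (h (T (fst z)) (U (snd z))) \<partial>K)
        = (\<integral>\<^sup>+ z. ennreal (w (T (fst z)) (U (snd z))) * ennreal (h (T (fst z)) (U (snd z))) \<partial>(\<mu> \<Otimes>\<^sub>M \<nu>))"
      unfolding K_def by (subst nn_integral_density) simp_all
    also have "\<dots> = (\<integral>\<^sup>+ x. (\<integral>\<^sup>+ y. ennreal (w (T x) (U y) * h (T x) (U y)) \<partial>\<nu>) \<partial>\<mu>)"
      by (subst N.nn_integral_fst[symmetric]) (simp_all add: ennreal_mult wTU h)
    also have "\<dots> = (\<integral>\<^sup>+ x. (\<Sum>t\<in>range U. ennreal (w (T x) t * h (T x) t) * emeasure \<nu> (U -` {t})) \<partial>\<mu>)"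
      by (intro nn_integral_cong)
        (use nn_integral_finite_range[OF U\<nu>, of "\<lambda>t. ennreal (w (T _) t * h (T _) t)"] in simp)
    also have "\<dots> = (\<Sum>s\<in>range T. (\<Sum>t\<in>range U. ennreal (w s t * h s t) * emeasure \<nu> (U -` {t})) * emeasure \<mu> (T -` {s}))"
      using nn_integral_finite_range[OF T\<mu>, of "\<lambda>s. \<Sum>t\<in>range U. ennreal (w s t * h s t) * emeasure \<nu> (U -` {t})"] by simp
    also have "\<dots> = (\<Sum>s\<in>range T. \<Sum>t\<in>range U. ennreal (h s t * \<pi> s t))"
      unfolding sum_distrib_right
    proof (intro sum.cong refl)
      fix s t assume st: "s \<in> range T" "t \<in> range U"
      have "ennreal (w s t * h s t) * emeasure \<nu> (U -` {t}) * emeasure \<mu> (T -` {s})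
          = ennreal (h s t * (w s t * q t * p s))"
        using w[OF st] h[of s t]
        by (simp add: M.emeasure_eq_measure N.emeasure_eq_measure p_def q_def mult_ac flip: ennreal_mult)
      then show "ennreal (w s t * h s t) * emeasure \<nu> (U -` {t}) * emeasure \<mu> (T -` {s}) = ennreal (h s t * \<pi> s t)"
        by (simp add: wpq[OF st])
    qed
    also have "\<dots> = ennreal (\<Sum>s\<in>range T. \<Sum>t\<in>range U. h s t * \<pi> s t)"
      using pos h by (simp add: sum_ennreal sum_nonneg)
    finally show ?thesis .
  qed
  ultimately show thesis using that by blast
qed

subsection \<open>Kantorovich-Rubinstein duality\<close>

text \<open>Separability gives maps of finite range that converge pointwise to the identity with
  \<open>dist (F i x) z \<le> 2 * dist x z\<close>. The displacement is therefore at most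
  \<open>3 * dist z x\<close>, and dominated convergence sends its mean to 0. One sequence serves
  all measures.\<close>

lemma simple_approximation_of_id:
  fixes z :: "'a::{metric_space, second_countable_topology}"
  obtains F :: "nat \<Rightarrow> 'a \<Rightarrow> 'a" where
    "\<And>i. simple_function borel (F i)"
    "\<And>i \<mu>. \<mu> \<in> borel_probs1 \<Longrightarrow> integrable \<mu> (\<lambda>x. dist x (F i x))"
    "\<And>\<mu>. \<mu> \<in> borel_probs1 \<Longrightarrow> (\<lambda>i. \<integral>x. dist x (F i x) \<partial>\<mu>) \<longlonglongrightarrow> 0"
proof -
  obtain F :: "nat \<Rightarrow> 'a \<Rightarrow> 'a" where F: "\<And>i. simple_function borel (F i)"
    "\<And>x. (\<lambda>i. F i x) \<longlonglongrightarrow> x" "\<And>i x. dist (F i x) z \<le> 2 * dist x z"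
    using borel_measurable_implies_sequence_metric[of "\<lambda>x. x" "borel :: 'a measure" z] by auto
  have [measurable]: "F i \<in> borel_measurable borel" for i
    using F(1) by (rule borel_measurable_simple_function)
  have meas: "(\<lambda>x. dist x (F i x)) \<in> borel_measurable borel" for i
    by measurable
  have bound: "norm (dist x (F i x)) \<le> 3 * dist z x" for i x
    using dist_triangle2[of x "F i x" z] F(3)[of i x] by (simp add: dist_commute)
  have lim: "(\<lambda>i. \<integral>x. dist x (F i x) \<partial>\<mu>) \<longlonglongrightarrow> 0"
    and int: "integrable \<mu> (\<lambda>x. dist x (F i x))" if \<mu>: "\<mu> \<in> borel_probs1" for \<mu> i
  proof -
    note [simp] = borel_probsD(2)[OF borel_probs1_borel_probs[OF \<mu>]]
    have m: "(\<lambda>x. dist x (F i x)) \<in> borel_measurable \<mu>" for i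
      by (subst measurable_cong_sets[of \<mu> borel borel borel]) (simp_all add: meas)
    have dom: "integrable \<mu> (\<lambda>x. 3 * dist z x)"
      using borel_probs1_dist_integrable[OF \<mu>] by simp
    have "(\<lambda>i. dist x (F i x)) \<longlonglongrightarrow> 0" for x
      using tendsto_dist[OF tendsto_const[of x] F(2)[of x]] by simp
    then have "(\<lambda>i. \<integral>x. dist x (F i x) \<partial>\<mu>) \<longlonglongrightarrow> (\<integral>x. 0 \<partial>\<mu>)"
      using m dom bound by (intro integral_dominated_convergence[where w = "\<lambda>x. 3 * dist z x"]) auto
    then show "(\<lambda>i. \<integral>x. dist x (F i x) \<partial>\<mu>) \<longlonglongrightarrow> 0" by simp
    show "integrable \<mu> (\<lambda>x. dist x (F i x))"
      by (rule Bochner_Integration.integrable_bound[OF dom m]) (use bound in \<open>auto intro!: AE_I2 order_trans[OF bound]\<close>)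
  qed
  show thesis using that[OF F(1) int lim] by blast
qed

text \<open>For the lifted coupling, the triangle inequality is applied along the path from
  \<open>x\<close> to \<open>T x\<close> to \<open>T y\<close> to \<open>y\<close>. The outer terms
  see one marginal each; the middle one depends on labels only.\<close>

lemma W1_le_block_cost:
  fixes \<mu> \<nu> :: "'a::{metric_space, second_countable_topology} measure"
  assumes \<mu>: "\<mu> \<in> borel_probs" and \<nu>: "\<nu> \<in> borel_probs"
    and T: "simple_function borel T"
    and int\<mu>: "integrable \<mu> (\<lambda>x. dist x (T x))" and int\<nu>: "integrable \<nu> (\<lambda>x. dist x (T x))"
    and pos: "\<And>s t. s \<in> range T \<Longrightarrow> t \<in> range T \<Longrightarrow> 0 \<le> \<pi> s t"
    and row: "\<And>s. s \<in> range T \<Longrightarrow> (\<Sum>t\<in>range T. \<pi> s t) = measure \<mu> (T -` {s})"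
    and col: "\<And>t. t \<in> range T \<Longrightarrow> (\<Sum>s\<in>range T. \<pi> s t) = measure \<nu> (T -` {t})"
  shows "W1 \<mu> \<nu> \<le> ennreal ((\<integral>x. dist x (T x) \<partial>\<mu>) + (\<Sum>s\<in>range T. \<Sum>t\<in>range T. dist s t * \<pi> s t)
    + (\<integral>x. dist x (T x) \<partial>\<nu>))"
proof -
  obtain K where K: "K \<in> couplings \<mu> \<nu>"
    "\<And>h. (\<And>s t. 0 \<le> h s t) \<Longrightarrow> (\<integral>\<^sup>+ z. ennreal (h (T (fst z)) (T (snd z))) \<partial>K)
      = ennreal (\<Sum>s\<in>range T. \<Sum>t\<in>range T. h s t * \<pi> s t)"
    by (rule block_coupling[OF \<mu> \<nu> T T pos row col]) auto
  note [measurable_cong] = couplingsD(2)[OF K(1)]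
  note [measurable] = couplings_measurable[OF K(1)]
  have [measurable]: "T \<in> borel_measurable borel"
    using T by (rule borel_measurable_simple_function)
  have dT: "(\<lambda>x. ennreal (dist x (T x))) \<in> borel_measurable borel"
    by measurable
  have m: "(\<lambda>z. ennreal (dist (fst z) (T (fst z)))) \<in> borel_measurable K"
    "(\<lambda>z. ennreal (dist (T (fst z)) (T (snd z)))) \<in> borel_measurable K"
    "(\<lambda>z. ennreal (dist (snd z) (T (snd z)))) \<in> borel_measurable K"
    by measurable
  have "W1 \<mu> \<nu> \<le> (\<integral>\<^sup>+ z. ennreal (dist (fst z) (snd z)) \<partial>K)"
    unfolding W1_def using K(1) by (rule INF_lower)
  also have "\<dots> \<le> (\<integral>\<^sup>+ z. ennreal (dist (fst z) (T (fst z))) + ennreal (dist (T (fst z)) (T (snd z)))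
      + ennreal (dist (snd z) (T (snd z))) \<partial>K)"
  proof (rule nn_integral_mono)
    fix z
    have "dist (fst z) (snd z) \<le> dist (fst z) (T (fst z)) + dist (T (fst z)) (T (snd z)) + dist (snd z) (T (snd z))"
      by (smt (verit) dist_triangle dist_commute)
    then show "ennreal (dist (fst z) (snd z)) \<le> ennreal (dist (fst z) (T (fst z)))
        + ennreal (dist (T (fst z)) (T (snd z))) + ennreal (dist (snd z) (T (snd z)))"
      by (simp flip: ennreal_plus)
  qed
  also have "\<dots> = (\<integral>\<^sup>+ z. ennreal (dist (fst z) (T (fst z))) \<partial>K) + (\<integral>\<^sup>+ z. ennreal (dist (T (fst z)) (T (snd z))) \<partial>K)
      + (\<integral>\<^sup>+ z. ennreal (dist (snd z) (T (snd z))) \<partial>K)"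
    by (simp only: nn_integral_add[OF borel_measurable_add[OF m(1,2)] m(3)] nn_integral_add[OF m(1,2)])
  also have "(\<integral>\<^sup>+ z. ennreal (dist (fst z) (T (fst z))) \<partial>K) = (\<integral>\<^sup>+ x. ennreal (dist x (T x)) \<partial>distr K borel fst)"
    by (rule nn_integral_distr[symmetric]) (use couplings_measurable[OF K(1)] dT in simp_all)
  also have "\<dots> = ennreal (\<integral>x. dist x (T x) \<partial>\<mu>)"
    using int\<mu> by (subst nn_integral_eq_integral) (auto simp: couplingsD(3)[OF K(1)])
  also have "(\<integral>\<^sup>+ z. ennreal (dist (snd z) (T (snd z))) \<partial>K) = (\<integral>\<^sup>+ x. ennreal (dist x (T x)) \<partial>distr K borel snd)"
    by (rule nn_integral_distr[symmetric]) (use couplings_measurable[OF K(1)] dT in simp_all)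
  also have "\<dots> = ennreal (\<integral>x. dist x (T x) \<partial>\<nu>)"
    using int\<nu> by (subst nn_integral_eq_integral) (auto simp: couplingsD(4)[OF K(1)])
  also have "(\<integral>\<^sup>+ z. ennreal (dist (T (fst z)) (T (snd z))) \<partial>K) = ennreal (\<Sum>s\<in>range T. \<Sum>t\<in>range T. dist s t * \<pi> s t)"
    by (rule K(2)) simp
  finally show ?thesis
    using pos by (simp add: sum_nonneg flip: ennreal_plus)
qed

text \<open>A finite minimum of 1-Lipschitz functions; it is the c-transform of
  \<open>\<psi>\<close> for the metric as cost.\<close>

lemma lipschitz_on_Min_dist:
  fixes \<psi> :: "'a::metric_space \<Rightarrow> real"
  assumes S: "finite S" "S \<noteq> {}"
  shows "1-lipschitz_on UNIV (\<lambda>x. Min ((\<lambda>t. dist x t - \<psi> t) ` S))"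
proof -
  define g where "g x = Min ((\<lambda>t. dist x t - \<psi> t) ` S)" for x
  have le: "g x \<le> g y + dist x y" for x y
  proof -
    have "g y \<in> (\<lambda>t. dist y t - \<psi> t) ` S"
      unfolding g_def using S by (intro Min_in) auto
    then obtain t where t: "t \<in> S" "g y = dist y t - \<psi> t" by auto
    then have "g x \<le> dist x t - \<psi> t" unfolding g_def using S by (intro Min_le) auto
    also have "\<dots> \<le> g y + dist x y" using t dist_triangle[of x t y] by simp
    finally show ?thesis .
  qed
  have "\<bar>g x - g y\<bar> \<le> dist x y" for x y
    using le[of x y] le[of y x] by (simp add: dist_commute abs_le_iff)
  then show ?thesis
    by (simp add: lipschitz_on_def dist_real_def flip: g_def)
qed

text \<open>The error \<open>e\<close> is split into five parts: one for the finite duality, two for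
  moving both measures to the range of \<open>T\<close>, and two for replacing
  \<open>g (T x)\<close> by \<open>g x\<close> in the two integrals.\<close>

lemma W1_almost_attained:
  fixes \<mu> \<nu> :: "'a::{metric_space, second_countable_topology} measure"
  assumes \<mu>1: "\<mu> \<in> borel_probs1" and \<nu>1: "\<nu> \<in> borel_probs1" and e: "0 < e"
  obtains g :: "'a \<Rightarrow> real" where "1-lipschitz_on UNIV g" "W1 \<mu> \<nu> \<le> ennreal ((\<integral>x. g x \<partial>\<mu>) - (\<integral>x. g x \<partial>\<nu>) + e)"
proof -
  note \<mu> = borel_probs1_borel_probs[OF \<mu>1] and \<nu> = borel_probs1_borel_probs[OF \<nu>1]
  interpret M: prob_space \<mu> using borel_probsD[OF \<mu>] by simp
  interpret N: prob_space \<nu> using borel_probsD[OF \<nu>] by simp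
  obtain F :: "nat \<Rightarrow> 'a \<Rightarrow> 'a" where F: "\<And>i. simple_function borel (F i)"
    "\<And>i \<mu>. \<mu> \<in> borel_probs1 \<Longrightarrow> integrable \<mu> (\<lambda>x. dist x (F i x))"
    "\<And>\<mu>. \<mu> \<in> borel_probs1 \<Longrightarrow> (\<lambda>i. \<integral>x. dist x (F i x) \<partial>\<mu>) \<longlonglongrightarrow> 0"
    using simple_approximation_of_id[where 'a = 'a] by blast
  have "eventually (\<lambda>i. (\<integral>x. dist x (F i x) \<partial>\<mu>) < e / 5 \<and> (\<integral>x. dist x (F i x) \<partial>\<nu>) < e / 5) sequentially"
    using e order_tendstoD(2)[OF F(3)[OF \<mu>1], of "e / 5"] order_tendstoD(2)[OF F(3)[OF \<nu>1], of "e / 5"]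
    by (auto intro: eventually_conj)
  then obtain i where i: "(\<integral>x. dist x (F i x) \<partial>\<mu>) < e / 5" "(\<integral>x. dist x (F i x) \<partial>\<nu>) < e / 5"
    by (auto simp: eventually_sequentially)
  define T where "T = F i"
  have T: "simple_function borel T" by (simp add: T_def F)
  have T\<mu>: "simple_function \<mu> T" and T\<nu>: "simple_function \<nu> T"
    using T borel_probsD(2,3)[OF \<mu>] borel_probsD(2,3)[OF \<nu>] by (auto simp: simple_function_def)
  have int: "integrable \<mu> (\<lambda>x. dist x (T x))" "integrable \<nu> (\<lambda>x. dist x (T x))"
    by (simp_all add: T_def F \<mu>1 \<nu>1)
  have fin: "finite (range T)" using T by (auto simp: simple_function_def)
  note space [simp] = borel_probsD(3)[OF \<mu>] borel_probsD(3)[OF \<nu>]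
  note sum\<mu> = M.integral_finite_range[OF T\<mu>, unfolded space Int_UNIV_right]
  note sum\<nu> = N.integral_finite_range[OF T\<nu>, unfolded space Int_UNIV_right]
  have "(\<Sum>s\<in>range T. measure \<mu> (T -` {s})) = 1" "(\<Sum>s\<in>range T. measure \<nu> (T -` {s})) = 1"
    using sum\<mu>(2)[of "\<lambda>s. 1"] sum\<nu>(2)[of "\<lambda>s. 1"] M.prob_space N.prob_space by simp_all
  then obtain \<pi> \<phi> \<psi> where \<pi>:
    "\<And>s t. s \<in> range T \<Longrightarrow> t \<in> range T \<Longrightarrow> 0 \<le> \<pi> s t"
    "\<And>s. s \<in> range T \<Longrightarrow> (\<Sum>t\<in>range T. \<pi> s t) = measure \<mu> (T -` {s})"
    "\<And>t. t \<in> range T \<Longrightarrow> (\<Sum>s\<in>range T. \<pi> s t) = measure \<nu> (T -` {t})"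
    and \<phi>\<psi>: "\<And>s t. s \<in> range T \<Longrightarrow> t \<in> range T \<Longrightarrow> \<phi> s + \<psi> t \<le> dist s t"
    and opt: "(\<Sum>s\<in>range T. \<Sum>t\<in>range T. dist s t * \<pi> s t)
      < (\<Sum>s\<in>range T. \<phi> s * measure \<mu> (T -` {s})) + (\<Sum>t\<in>range T. \<psi> t * measure \<nu> (T -` {t})) + e / 5"
    using finite_kantorovich_duality[OF fin fin, of "\<lambda>s. measure \<mu> (T -` {s})" "\<lambda>s. measure \<nu> (T -` {s})"
      "e / 5" dist] e by (simp add: measure_nonneg) blast
  \<comment> \<open>On the range of \<open>T\<close>, the pair \<open>(g, - g)\<close> dominates \<open>(\<phi>, \<psi>)\<close>.\<close>
  define g where "g x = Min ((\<lambda>t. dist x t - \<psi> t) ` range T)" for x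
  have g: "1-lipschitz_on UNIV g"
    unfolding g_def using fin by (intro lipschitz_on_Min_dist) auto
  have \<phi>g: "\<phi> s \<le> g s" if "s \<in> range T" for s
    unfolding g_def using fin \<phi>\<psi>[OF that] by (subst Min_ge_iff) (auto simp: le_diff_eq)
  have g\<psi>: "g t \<le> - \<psi> t" if "t \<in> range T" for t
  proof -
    have "g t \<le> dist t t - \<psi> t"
      unfolding g_def using fin imageI[OF that, of "\<lambda>s. dist t s - \<psi> s"] by (intro Min_le) auto
    then show ?thesis by simp
  qed
  have "(\<Sum>s\<in>range T. \<phi> s * measure \<mu> (T -` {s})) \<le> (\<integral>x. g (T x) \<partial>\<mu>)"
    unfolding sum\<mu>(2) by (rule sum_mono, rule mult_right_mono[OF \<phi>g]) auto
  moreover have "(\<integral>x. g (T x) \<partial>\<nu>) \<le> (\<Sum>t\<in>range T. - \<psi> t * measure \<nu> (T -` {t}))"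
    unfolding sum\<nu>(2) by (rule sum_mono, rule mult_right_mono[OF g\<psi>]) auto
  moreover have "(\<integral>x. g (T x) \<partial>\<mu>) \<le> (\<integral>x. g x + dist x (T x) \<partial>\<mu>)"
  proof (rule integral_mono)
    show "g (T x) \<le> g x + dist x (T x)" for x
      using lipschitz_onD[OF g, of x "T x"] by (simp add: dist_real_def abs_le_iff)
  qed (use int sum\<mu>(1) borel_probs1_lipschitz_integrable[OF \<mu>1 g] in auto)
  moreover have "(\<integral>x. g x \<partial>\<nu>) \<le> (\<integral>x. g (T x) + dist x (T x) \<partial>\<nu>)"
  proof (rule integral_mono)
    show "g x \<le> g (T x) + dist x (T x)" for x
      using lipschitz_onD[OF g, of x "T x"] by (simp add: dist_real_def abs_le_iff)
  qed (use int sum\<nu>(1) borel_probs1_lipschitz_integrable[OF \<nu>1 g] in auto)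
  ultimately have "(\<integral>x. dist x (T x) \<partial>\<mu>) + (\<Sum>s\<in>range T. \<Sum>t\<in>range T. dist s t * \<pi> s t) + (\<integral>x. dist x (T x) \<partial>\<nu>)
      \<le> (\<integral>x. g x \<partial>\<mu>) - (\<integral>x. g x \<partial>\<nu>) + e"
    using opt i int sum\<mu>(1)[of g] sum\<nu>(1)[of g] borel_probs1_lipschitz_integrable[OF \<mu>1 g] borel_probs1_lipschitz_integrable[OF \<nu>1 g]
    by (simp add: sum_negf flip: T_def)
  then have "W1 \<mu> \<nu> \<le> ennreal ((\<integral>x. g x \<partial>\<mu>) - (\<integral>x. g x \<partial>\<nu>) + e)"
    using W1_le_block_cost[OF \<mu> \<nu> T int \<pi>] by (meson ennreal_leI order_trans)
  with g show thesis by (rule that)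
qed

section \<open>Compactness and existence of a maximiser\<close>

text \<open>The Arzela-Ascoli argument with pointwise convergence: a diagonal subsequence converges
  on a countable dense set, and the common Lipschitz constant carries the Cauchy property to all
  points.\<close>

lemma lipschitz_convergent_subsequence:
  fixes g :: "nat \<Rightarrow> 'a::{metric_space, second_countable_topology} \<Rightarrow> real"
  assumes g: "\<And>n. 1-lipschitz_on UNIV (g n)" and z: "\<And>n. g n z = 0"
  obtains k h where "strict_mono k" "1-lipschitz_on UNIV h" "\<And>x. (\<lambda>n. g (k n) x) \<longlonglongrightarrow> h x"
proof -
  have gz: "\<bar>g n x\<bar> \<le> dist x z" for n x
    using lipschitz_onD[OF g, of x z n] by (simp add: dist_real_def z)
  obtain D :: "'a set" where D: "countable D" "\<And>X. open X \<Longrightarrow> X \<noteq> {} \<Longrightarrow> \<exists>d\<in>D. d \<in> X"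
    by (erule countable_dense_setE)
  \<comment> \<open>The diagonal argument takes one bound for all points, while \<open>g n x\<close>
    is bounded only by \<open>dist x z\<close>; the weight evens this out and is removed again in
    \<open>convD\<close>.\<close>
  have "norm (g n x / (1 + dist x z)) \<le> 1" for n x
    using gz[of n x] by (simp add: divide_le_eq add_nonneg_pos abs_of_pos)
  then obtain k where k: "strict_mono (k :: nat \<Rightarrow> nat)"
    "\<And>x. x \<in> D \<Longrightarrow> \<exists>l. (\<lambda>n. g (k n) x / (1 + dist x z)) \<longlonglongrightarrow> l"
    using function_convergent_subsequence[OF D(1), of "\<lambda>n x. g n x / (1 + dist x z)" 1] by blast
  have convD: "Cauchy (\<lambda>n. g (k n) d)" if d: "d \<in> D" for d
  proof -
    obtain l where "(\<lambda>n. g (k n) d / (1 + dist d z)) \<longlonglongrightarrow> l" using k(2)[OF d] by blast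
    then have "(\<lambda>n. g (k n) d / (1 + dist d z) * (1 + dist d z)) \<longlonglongrightarrow> l * (1 + dist d z)"
      by (intro tendsto_intros)
    moreover have "1 + dist d z \<noteq> 0" using zero_le_dist[of d z] by linarith
    ultimately show ?thesis by (auto intro: LIMSEQ_imp_Cauchy)
  qed
  have "Cauchy (\<lambda>n. g (k n) x)" for x
  proof (rule metric_CauchyI)
    fix e :: real assume e: "0 < e"
    then obtain d where d: "d \<in> D" "d \<in> ball x (e / 3)" using D(2)[of "ball x (e / 3)"] by auto
    obtain M where M: "\<And>m n. m \<ge> M \<Longrightarrow> n \<ge> M \<Longrightarrow> dist (g (k m) d) (g (k n) d) < e / 3"
      using metric_CauchyD[OF convD[OF d(1)], of "e / 3"] e by auto
    have "dist (g (k m) x) (g (k n) x) < e" if "m \<ge> M" "n \<ge> M" for m n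
      using M[OF that] lipschitz_onD[OF g, of x d "k m", simplified] lipschitz_onD[OF g, of x d "k n", simplified] d(2)
      unfolding dist_real_def mem_ball by linarith
    then show "\<exists>M. \<forall>m\<ge>M. \<forall>n\<ge>M. dist (g (k m) x) (g (k n) x) < e" by blast
  qed
  then have lim: "(\<lambda>n. g (k n) x) \<longlonglongrightarrow> lim (\<lambda>n. g (k n) x)" for x
    by (simp add: Cauchy_convergent_iff convergent_LIMSEQ_iff)
  show thesis
  proof (rule that[OF k(1) _ lim])
    show "1-lipschitz_on UNIV (\<lambda>x. lim (\<lambda>n. g (k n) x))"
    proof (rule lipschitz_onI)
      fix x y
      have "(\<lambda>n. dist (g (k n) x) (g (k n) y)) \<longlonglongrightarrow> dist (lim (\<lambda>n. g (k n) x)) (lim (\<lambda>n. g (k n) y))"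
        by (intro tendsto_dist lim)
      then show "dist (lim (\<lambda>n. g (k n) x)) (lim (\<lambda>n. g (k n) y)) \<le> 1 * dist x y"
        by (rule LIMSEQ_le_const2) (use lipschitz_onD[OF g] in auto)
    qed simp
  qed
qed

text \<open>Subtracting \<open>f z\<close> leaves the difference of the integrals unchanged, as both
  measures have mass 1, and makes \<open>dist z\<close> a common dominating function. The limit
  attains the distance from above; \<open>W1_lipschitz_bound\<close> with constant 1 gives the
  converse.\<close>

theorem kantorovich_rubinstein:
  fixes \<mu> \<nu> :: "'a::{metric_space, second_countable_topology} measure"
  assumes \<mu>: "\<mu> \<in> borel_probs1" and \<nu>: "\<nu> \<in> borel_probs1"
  obtains g :: "'a \<Rightarrow> real" where "1-lipschitz_on UNIV g" "W1 \<mu> \<nu> = ennreal \<bar>(\<integral>x. g x \<partial>\<mu>) - (\<integral>x. g x \<partial>\<nu>)\<bar>"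
proof -
  interpret M: prob_space \<mu> using borel_probsD[OF borel_probs1_borel_probs[OF \<mu>]] by simp
  interpret N: prob_space \<nu> using borel_probsD[OF borel_probs1_borel_probs[OF \<nu>]] by simp
  \<comment> \<open>Any point may serve for the normalisation; types are nonempty.\<close>
  define z :: 'a where "z = undefined"
  have "\<exists>g :: 'a \<Rightarrow> real. 1-lipschitz_on UNIV g \<and> g z = 0
      \<and> W1 \<mu> \<nu> \<le> ennreal ((\<integral>x. g x \<partial>\<mu>) - (\<integral>x. g x \<partial>\<nu>) + 1 / real (Suc n))" for n
  proof -
    obtain f :: "'a \<Rightarrow> real" where f: "1-lipschitz_on UNIV f"
      "W1 \<mu> \<nu> \<le> ennreal ((\<integral>x. f x \<partial>\<mu>) - (\<integral>x. f x \<partial>\<nu>) + 1 / real (Suc n))"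
      by (rule W1_almost_attained[OF \<mu> \<nu>, of "1 / real (Suc n)"]) auto
    note int = borel_probs1_lipschitz_integrable[OF \<mu> f(1)] borel_probs1_lipschitz_integrable[OF \<nu> f(1)]
    show ?thesis
      using f int M.prob_space N.prob_space
      by (intro exI[of _ "\<lambda>x. f x - f z"]) (auto simp: lipschitz_on_def dist_real_def)
  qed
  then obtain g :: "nat \<Rightarrow> 'a \<Rightarrow> real" where g: "\<And>n. 1-lipschitz_on UNIV (g n)" "\<And>n. g n z = 0"
    and opt: "\<And>n. W1 \<mu> \<nu> \<le> ennreal ((\<integral>x. g n x \<partial>\<mu>) - (\<integral>x. g n x \<partial>\<nu>) + 1 / real (Suc n))"
    by metis
  obtain k h where k: "strict_mono k" and h: "1-lipschitz_on UNIV h" and lim: "\<And>x. (\<lambda>n. g (k n) x) \<longlonglongrightarrow> h x"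
    using lipschitz_convergent_subsequence[of g z] g by blast
  have intlim: "(\<lambda>n. \<integral>x. g (k n) x \<partial>\<rho>) \<longlonglongrightarrow> (\<integral>x. h x \<partial>\<rho>)" if \<rho>: "\<rho> \<in> borel_probs1" for \<rho>
  proof (rule integral_dominated_convergence)
    show "h \<in> borel_measurable \<rho>" "\<And>n. g (k n) \<in> borel_measurable \<rho>"
      using borel_probs1_lipschitz_integrable[OF \<rho>] h g(1) by auto
    show "integrable \<rho> (dist z)" by (rule borel_probs1_dist_integrable[OF \<rho>])
    show "AE x in \<rho>. (\<lambda>n. g (k n) x) \<longlonglongrightarrow> h x" using lim by simp
    show "AE x in \<rho>. norm (g (k n) x) \<le> dist z x" for n
      using lipschitz_onD[OF g(1), of _ z "k n"] g(2) by (intro AE_I2) (simp add: dist_real_def dist_commute)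
  qed
  have "(\<lambda>n. 1 / real (Suc (k n))) \<longlonglongrightarrow> 0"
    using LIMSEQ_subseq_LIMSEQ[OF lim_1_over_n[THEN LIMSEQ_Suc] k] by (simp add: o_def)
  then have "(\<lambda>n. (\<integral>x. g (k n) x \<partial>\<mu>) - (\<integral>x. g (k n) x \<partial>\<nu>) + 1 / real (Suc (k n)))
      \<longlonglongrightarrow> (\<integral>x. h x \<partial>\<mu>) - (\<integral>x. h x \<partial>\<nu>) + 0"
    by (intro tendsto_intros intlim \<mu> \<nu>)
  then have "W1 \<mu> \<nu> \<le> ennreal ((\<integral>x. h x \<partial>\<mu>) - (\<integral>x. h x \<partial>\<nu>) + 0)"
    by (intro LIMSEQ_le_const[OF tendsto_ennrealI]) (use opt in auto)
  also have "\<dots> \<le> ennreal \<bar>(\<integral>x. h x \<partial>\<mu>) - (\<integral>x. h x \<partial>\<nu>)\<bar>"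
    by (intro ennreal_leI) simp
  finally have "W1 \<mu> \<nu> \<le> ennreal \<bar>(\<integral>x. h x \<partial>\<mu>) - (\<integral>x. h x \<partial>\<nu>)\<bar>" .
  moreover have "ennreal \<bar>(\<integral>x. h x \<partial>\<mu>) - (\<integral>x. h x \<partial>\<nu>)\<bar> \<le> ennreal 1 * W1 \<mu> \<nu>"
    using borel_probs1_borel_probs[OF \<mu>] borel_probs1_borel_probs[OF \<nu>] h
    by (rule W1_lipschitz_bound) (auto intro: borel_probs1_lipschitz_integrable[OF _ h] \<mu> \<nu>)
  ultimately show thesis using that[OF h] by (simp add: antisym)
qed

subsection \<open>Supports, tilted measures and the main theorem\<close>

lemma closed_supp: "closed (supp \<mu>)"
proof -
  have "- supp \<mu> = \<Union>{U. open U \<and> emeasure \<mu> U = 0}"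
    by (auto simp: supp_def not_gr_zero)
  then show ?thesis by (auto simp: closed_def)
qed

text \<open>The complement of the support is a union of null open sets, and a countable basis
  reduces it to a countable union of null basic sets.\<close>

lemma emeasure_Compl_supp:
  fixes \<mu> :: "'a::second_countable_topology measure"
  assumes "sets \<mu> = sets borel"
  shows "emeasure \<mu> (- supp \<mu>) = 0"
proof -
  obtain B :: "'a set set" where B: "countable B" "topological_basis B"
    using ex_countable_basis by blast
  define N where "N = {U \<in> B. emeasure \<mu> U = 0}"
  have "(\<Union>U\<in>N. U) \<in> null_sets \<mu>"
    using B assms by (intro null_sets_UN') (auto simp: N_def null_sets_def topological_basis_open)
  moreover have "- supp \<mu> \<subseteq> (\<Union>U\<in>N. U)"
  proof
    fix x assume "x \<in> - supp \<mu>"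
    then obtain U where U: "open U" "x \<in> U" "emeasure \<mu> U = 0"
      by (auto simp: supp_def not_gr_zero)
    then obtain V where V: "V \<in> B" "x \<in> V" "V \<subseteq> U"
      using topological_basisE[OF B(2)] by metis
    have "emeasure \<mu> V \<le> emeasure \<mu> U"
      using U V assms by (intro emeasure_mono) auto
    with U V show "x \<in> (\<Union>U\<in>N. U)" by (auto simp: N_def)
  qed
  ultimately show ?thesis
    using assms closed_supp[of \<mu>] by (metis emeasure_mono le_zero_eq null_setsD1 null_setsD2)
qed

lemma AE_supp_add_measure:
  fixes \<mu> \<nu> :: "'a::second_countable_topology measure"
  assumes "sets \<mu> = sets borel" "sets \<nu> = sets borel"
  shows "AE x in \<mu>. x \<in> supp (add_measure \<mu> \<nu>)" "AE x in \<nu>. x \<in> supp (add_measure \<mu> \<nu>)"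
proof -
  let ?S = "supp (add_measure \<mu> \<nu>)"
  have S: "- ?S \<in> sets borel" using closed_supp[of "add_measure \<mu> \<nu>"] by auto
  then have "emeasure \<mu> (- ?S) + emeasure \<nu> (- ?S) = 0"
    using emeasure_Compl_supp[of "add_measure \<mu> \<nu>"] assms by (simp add: emeasure_add_measure)
  then have "- ?S \<in> null_sets \<mu>" "- ?S \<in> null_sets \<nu>"
    using S assms by (auto simp: null_sets_def)
  then show "AE x in \<mu>. x \<in> ?S" "AE x in \<nu>. x \<in> ?S"
    by (auto elim!: AE_I')
qed

section \<open>Measures at distance zero\<close>

lemma measure_eq_on_closed_imp_eq:
  fixes \<mu> \<nu> :: "'a::topological_space measure"
  assumes \<mu>: "\<mu> \<in> borel_probs" and \<nu>: "\<nu> \<in> borel_probs"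
    and eq: "\<And>C. closed C \<Longrightarrow> measure \<mu> C = measure \<nu> C"
  shows "\<mu> = \<nu>"
proof -
  interpret M: prob_space \<mu> using borel_probsD[OF \<mu>] by simp
  interpret N: prob_space \<nu> using borel_probsD[OF \<nu>] by simp
  have "sets (borel :: 'a measure) = sigma_sets UNIV {C. closed C}"
    by (subst borel_eq_closed) simp
  then have sets: "sets \<mu> = sigma_sets UNIV {C. closed C}" "sets \<nu> = sigma_sets UNIV {C. closed C}"
    using borel_probsD(2)[OF \<mu>] borel_probsD(2)[OF \<nu>] by simp_all
  show ?thesis
    by (rule measure_eqI_generator_eq[where A = "\<lambda>_. UNIV", OF _ _ _ sets])
      (auto simp: Int_stable_def eq M.emeasure_eq_measure N.emeasure_eq_measure)
qed

text \<open>At distance 0 the integrals of integrable Lipschitz functions agree, whatever their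
  constant. The cutoffs \<open>f n\<close> are \<open>n\<close>-Lipschitz, bounded by 1, and
  converge to the indicator of the closed set \<open>C\<close>, so both measures agree on
  \<open>C\<close>.\<close>

lemma W1_eq_0_imp_eq:
  fixes \<mu> \<nu> :: "'a::{metric_space, second_countable_topology} measure"
  assumes \<mu>: "\<mu> \<in> borel_probs" and \<nu>: "\<nu> \<in> borel_probs" and W: "W1 \<mu> \<nu> = 0"
  shows "\<mu> = \<nu>"
proof (rule measure_eq_on_closed_imp_eq[OF \<mu> \<nu>])
  fix C :: "'a set" assume C: "closed C"
  interpret M: prob_space \<mu> using borel_probsD[OF \<mu>] by simp
  interpret N: prob_space \<nu> using borel_probsD[OF \<nu>] by simp
  show "measure \<mu> C = measure \<nu> C"
  \<comment> \<open>By convention \<open>infdist x {} = 0\<close>, so for the empty set the cutoffs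
    would be constantly 1.\<close>
  proof (cases "C = {}")
    case False
    define f where "f n x = max 0 (1 - real n * infdist x C)" for n x
    have lip: "(real n)-lipschitz_on UNIV (f n)" for n
    proof (rule lipschitz_onI)
      fix x y
      have "\<bar>real n * infdist x C - real n * infdist y C\<bar> \<le> real n * dist x y"
        using mult_left_mono[OF infdist_triangle_abs[of x C y], of "real n"]
        by (simp add: abs_mult flip: right_diff_distrib)
      then show "dist (f n x) (f n y) \<le> real n * dist x y"
        by (simp add: f_def dist_real_def)
    qed simp
    have bound: "\<bar>f n x\<bar> \<le> 1" for n x
      by (simp add: f_def infdist_nonneg)
    have conv: "(\<lambda>n. f n x) \<longlonglongrightarrow> indicator C x" for x
    proof (cases "x \<in> C")
      case True
      then show ?thesis by (simp add: f_def)
    next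
      case out: False
      then have "0 < infdist x C"
        using C False by (intro infdist_pos_not_in_closed)
      then obtain N where N: "1 < real N * infdist x C"
        using reals_Archimedean3 by blast
      have "f n x = 0" if "n \<ge> N" for n
      proof -
        have "real N * infdist x C \<le> real n * infdist x C"
          using that by (intro mult_right_mono) (auto simp: infdist_nonneg)
        with N show ?thesis by (simp add: f_def)
      qed
      then have "eventually (\<lambda>n. f n x = indicator C x) sequentially"
        using out by (auto simp: eventually_sequentially)
      then show ?thesis by (rule tendsto_eventually)
    qed
    have int: "integrable \<rho> (f n)" and lim: "(\<lambda>n. \<integral>x. f n x \<partial>\<rho>) \<longlonglongrightarrow> measure \<rho> C"
      if \<rho>: "\<rho> \<in> borel_probs" for \<rho> n
    proof -
      interpret R: prob_space \<rho> using borel_probsD[OF \<rho>] by simp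
      have meas: "f n \<in> borel_measurable \<rho>" for n
        using lipschitz_on_UNIV_borel_measurable[OF lip]
        by (subst measurable_cong_sets[OF borel_probsD(2)[OF \<rho>] refl])
      have CR: "C \<in> sets \<rho>" using C by (simp add: borel_probsD(2)[OF \<rho>])
      show "integrable \<rho> (f n)"
        by (rule R.integrable_const_bound[where B = 1]) (simp_all add: bound meas)
      have "(\<lambda>n. \<integral>x. f n x \<partial>\<rho>) \<longlonglongrightarrow> (\<integral>x. indicator C x \<partial>\<rho>)"
        using conv bound meas CR
        by (intro integral_dominated_convergence[where w = "\<lambda>_. 1"])
          auto
      then show "(\<lambda>n. \<integral>x. f n x \<partial>\<rho>) \<longlonglongrightarrow> measure \<rho> C"
        using C by (simp add: borel_probsD[OF \<rho>])
    qed
    have "(\<integral>x. f n x \<partial>\<mu>) = (\<integral>x. f n x \<partial>\<nu>)" for n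
      using W1_lipschitz_bound[OF \<mu> \<nu> lip int[OF \<mu>] int[OF \<nu>]] W by simp
    then show ?thesis
      using lim[OF \<mu>] lim[OF \<nu>] by (auto intro: LIMSEQ_unique)
  qed simp
qed

section \<open>Integration against tilted measures\<close>

lemma tilt_eq_density:
  assumes "partition_fn \<Phi> \<mu> = ennreal z" "0 < z"
  shows "tilt \<Phi> \<mu> = density \<mu> (\<lambda>x. ennreal (exp (- \<Phi> x) / z))"
  using assms by (simp add: tilt_def divide_ennreal)

text \<open>The exponentials cancel, so integrability comes from that of \<open>g\<close> against
  \<open>\<mu>\<close>, however large \<open>exp (\<Phi> x)\<close> may be.\<close>

lemma has_integral_tilt:
  fixes g :: "'a::topological_space \<Rightarrow> real"
  assumes \<mu>: "sets \<mu> = sets borel" and \<Phi>: "\<Phi> \<in> borel_measurable borel"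
    and Z: "partition_fn \<Phi> \<mu> = ennreal z" "0 < z" and g: "integrable \<mu> g"
  shows "integrable (tilt \<Phi> \<mu>) (\<lambda>x. g x * exp (\<Phi> x))"
    and "(\<integral>x. g x * exp (\<Phi> x) \<partial>tilt \<Phi> \<mu>) = (\<integral>x. g x \<partial>\<mu>) / z"
proof -
  note [measurable_cong] = \<mu>
  note [measurable] = \<Phi> borel_measurable_integrable[OF g]
  have eq: "(exp (- \<Phi> x) / z) *\<^sub>R (g x * exp (\<Phi> x)) = g x / z" for x
    by (simp add: exp_minus field_simps)
  show "integrable (tilt \<Phi> \<mu>) (\<lambda>x. g x * exp (\<Phi> x))"
    unfolding tilt_eq_density[OF Z] using Z(2) g
    by (subst integrable_density) (auto simp: eq simp del: real_scaleR_def)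
  show "(\<integral>x. g x * exp (\<Phi> x) \<partial>tilt \<Phi> \<mu>) = (\<integral>x. g x \<partial>\<mu>) / z"
    unfolding tilt_eq_density[OF Z] using Z(2) g
    by (subst integral_density) (auto simp: eq simp del: real_scaleR_def)
qed

lemma AE_tilt:
  assumes \<mu>: "sets \<mu> = sets borel" and \<Phi>: "\<Phi> \<in> borel_measurable borel"
    and Z: "partition_fn \<Phi> \<mu> = ennreal z" "0 < z" and P: "AE x in \<mu>. P x"
  shows "AE x in tilt \<Phi> \<mu>. P x"
proof -
  note [measurable_cong] = \<mu>
  note [measurable] = \<Phi>
  show ?thesis
    unfolding tilt_eq_density[OF Z] using P by (subst AE_density) auto
qed

text \<open>The two densities multiply to 1, so a measure can be recovered from its tilt and its
  partition function.\<close>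

lemma density_tilt:
  assumes \<mu>: "sets \<mu> = sets borel" and \<Phi>: "\<Phi> \<in> borel_measurable borel"
    and Z: "partition_fn \<Phi> \<mu> = ennreal z" "0 < z"
  shows "density (tilt \<Phi> \<mu>) (\<lambda>x. ennreal (z * exp (\<Phi> x))) = \<mu>"
proof -
  note [measurable_cong] = \<mu>
  note [measurable] = \<Phi>
  have "ennreal (exp (- \<Phi> x) / z) * ennreal (z * exp (\<Phi> x)) = 1" for x
    using Z(2) by (simp add: exp_minus field_simps flip: ennreal_mult)
  then show ?thesis
    unfolding tilt_eq_density[OF Z] by (subst density_density_eq) (simp_all add: density_1)
qed

text \<open>The integrability conjuncts certify that the integrals are genuine, since a
  non-integrable function has integral 0 by convention.\<close>

theorem proposition6p5:
  fixes \<mu>\<^sub>1 \<mu>\<^sub>2 :: "'a::polish_space measure" and \<Phi> :: "'a \<Rightarrow> real"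
  assumes "\<mu>\<^sub>1 \<in> borel_probs1" and "\<mu>\<^sub>2 \<in> borel_probs1"
    and "\<Phi> \<in> borel_measurable borel"
    and "0 < partition_fn \<Phi> \<mu>\<^sub>1" and "partition_fn \<Phi> \<mu>\<^sub>1 < \<infinity>"
    and "0 < partition_fn \<Phi> \<mu>\<^sub>2" and "partition_fn \<Phi> \<mu>\<^sub>2 < \<infinity>"
    and "tilt \<Phi> \<mu>\<^sub>1 \<in> borel_probs1" and "tilt \<Phi> \<mu>\<^sub>2 \<in> borel_probs1"
  shows "\<exists>g :: 'a \<Rightarrow> real.
      lip_norm UNIV g \<le> 1 \<and>
      integrable (tilt \<Phi> \<mu>\<^sub>1) (\<lambda>x. g x * exp (\<Phi> x)) \<and>
      integrable (tilt \<Phi> \<mu>\<^sub>2) (\<lambda>x. g x * exp (\<Phi> x)) \<and>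
      integrable \<mu>\<^sub>2 g \<and>
      W1 \<mu>\<^sub>1 \<mu>\<^sub>2 = partition_fn \<Phi> \<mu>\<^sub>1 * ennreal
        \<bar>(\<integral>x. g x * exp (\<Phi> x) \<partial>tilt \<Phi> \<mu>\<^sub>1) - (\<integral>x. g x * exp (\<Phi> x) \<partial>tilt \<Phi> \<mu>\<^sub>2)
          + (\<integral>x. g x \<partial>\<mu>\<^sub>2) * (1 / enn2real (partition_fn \<Phi> \<mu>\<^sub>2) - 1 / enn2real (partition_fn \<Phi> \<mu>\<^sub>1))\<bar> \<and>
      (partition_fn \<Phi> \<mu>\<^sub>1 = partition_fn \<Phi> \<mu>\<^sub>2 \<longrightarrow>
        W1 \<mu>\<^sub>1 \<mu>\<^sub>2 \<le> partition_fn \<Phi> \<mu>\<^sub>1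
          * lip_norm (supp (add_measure \<mu>\<^sub>1 \<mu>\<^sub>2)) (\<lambda>x. g x * exp (\<Phi> x))
          * W1 (tilt \<Phi> \<mu>\<^sub>1) (tilt \<Phi> \<mu>\<^sub>2) \<and>
        (lip_norm (supp (add_measure \<mu>\<^sub>1 \<mu>\<^sub>2)) (\<lambda>x. g x * exp (\<Phi> x)) = 0 \<longrightarrow>
          W1 \<mu>\<^sub>1 \<mu>\<^sub>2 = partition_fn \<Phi> \<mu>\<^sub>1
            * lip_norm (supp (add_measure \<mu>\<^sub>1 \<mu>\<^sub>2)) (\<lambda>x. g x * exp (\<Phi> x))
            * W1 (tilt \<Phi> \<mu>\<^sub>1) (tilt \<Phi> \<mu>\<^sub>2)))"
proof -
  define z1 where "z1 = enn2real (partition_fn \<Phi> \<mu>\<^sub>1)"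
  define z2 where "z2 = enn2real (partition_fn \<Phi> \<mu>\<^sub>2)"
  have Z1: "partition_fn \<Phi> \<mu>\<^sub>1 = ennreal z1" "0 < z1"
    using assms(4,5) by (simp_all add: z1_def enn2real_positive_iff less_top)
  have Z2: "partition_fn \<Phi> \<mu>\<^sub>2 = ennreal z2" "0 < z2"
    using assms(6,7) by (simp_all add: z2_def enn2real_positive_iff less_top)
  note bp = assms(1,2,8,9)[THEN borel_probs1_borel_probs]
  note sets = bp(1,2)[THEN borel_probsD(2)]
  obtain g :: "'a \<Rightarrow> real" where g: "1-lipschitz_on UNIV g"
    and W: "W1 \<mu>\<^sub>1 \<mu>\<^sub>2 = ennreal \<bar>(\<integral>x. g x \<partial>\<mu>\<^sub>1) - (\<integral>x. g x \<partial>\<mu>\<^sub>2)\<bar>"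
    using kantorovich_rubinstein[OF assms(1,2)] by blast
  define f where "f x = g x * exp (\<Phi> x)" for x
  note int1 = borel_probs1_lipschitz_integrable[OF assms(1) g]
  note int2 = borel_probs1_lipschitz_integrable[OF assms(2) g]
  note t1 = has_integral_tilt[OF sets(1) assms(3) Z1 int1, folded f_def]
  note t2 = has_integral_tilt[OF sets(2) assms(3) Z2 int2, folded f_def]
  let ?S = "supp (add_measure \<mu>\<^sub>1 \<mu>\<^sub>2)"
  have scale: "W1 \<mu>\<^sub>1 \<mu>\<^sub>2 = ennreal z1 * ennreal \<bar>(\<integral>x. f x \<partial>tilt \<Phi> \<mu>\<^sub>1) - (\<integral>x. f x \<partial>tilt \<Phi> \<mu>\<^sub>2)
      + (\<integral>x. g x \<partial>\<mu>\<^sub>2) * (1 / z2 - 1 / z1)\<bar>"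
  proof -
    \<comment> \<open>The correction term exchanges the factor \<open>1 / z2\<close> of the second
      integral for \<open>1 / z1\<close>, after which \<open>1 / z1\<close> is common to
      both.\<close>
    have eq: "(\<integral>x. g x \<partial>\<mu>\<^sub>1) - (\<integral>x. g x \<partial>\<mu>\<^sub>2)
        = z1 * ((\<integral>x. f x \<partial>tilt \<Phi> \<mu>\<^sub>1) - (\<integral>x. f x \<partial>tilt \<Phi> \<mu>\<^sub>2) + (\<integral>x. g x \<partial>\<mu>\<^sub>2) * (1 / z2 - 1 / z1))"
      using Z1(2) Z2(2) unfolding t1(2) t2(2) by (simp add: field_simps)
    show ?thesis
      using Z1(2) unfolding W eq abs_mult
      by (simp only: abs_of_pos ennreal_mult abs_ge_zero less_imp_le)
  qed
  have bound: "W1 \<mu>\<^sub>1 \<mu>\<^sub>2 \<le> ennreal z1 * lip_norm ?S f * W1 (tilt \<Phi> \<mu>\<^sub>1) (tilt \<Phi> \<mu>\<^sub>2)"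
    if eq: "z1 = z2"
  proof (cases "lip_norm ?S f = \<top>")
    case True
    show ?thesis
    \<comment> \<open>Since \<open>\<top> * 0 = 0\<close> in \<open>ennreal\<close>, the bound has
      content when the tilted measures are at distance 0; otherwise its right side is
      \<open>\<top>\<close>.\<close>
    proof (cases "W1 (tilt \<Phi> \<mu>\<^sub>1) (tilt \<Phi> \<mu>\<^sub>2) = 0")
      case W0: True
      have "\<mu>\<^sub>1 = density (tilt \<Phi> \<mu>\<^sub>1) (\<lambda>x. ennreal (z1 * exp (\<Phi> x)))"
        by (rule density_tilt[OF sets(1) assms(3) Z1, symmetric])
      also have "\<dots> = density (tilt \<Phi> \<mu>\<^sub>2) (\<lambda>x. ennreal (z2 * exp (\<Phi> x)))"
        by (simp only: W1_eq_0_imp_eq[OF bp(3,4) W0] eq)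
      also have "\<dots> = \<mu>\<^sub>2"
        by (rule density_tilt[OF sets(2) assms(3) Z2])
      finally have "\<mu>\<^sub>1 = \<mu>\<^sub>2" .
      \<comment> \<open>In the duality identity both integrals now coincide.\<close>
      then have "W1 \<mu>\<^sub>1 \<mu>\<^sub>2 = 0" unfolding W by simp
      then show ?thesis by (simp only: zero_le)
    next
      case False
      then show ?thesis using True Z1(2) by (simp add: ennreal_top_mult ennreal_mult_top)
    qed
  next
    case False
    define L where "L = enn2real (lip_norm ?S f)"
    have L: "lip_norm ?S f = ennreal L" "0 \<le> L"
      using False by (simp_all add: L_def less_top)
    then have "L-lipschitz_on ?S f"
      using lip_norm_le_iff[of L ?S f] by simp
    \<comment> \<open>Tilting preserves null sets, so the tilted measures also live on the support
      of the sum, where \<open>f\<close> is Lipschitz.\<close>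
    moreover have "AE x in tilt \<Phi> \<mu>\<^sub>1. x \<in> ?S" "AE x in tilt \<Phi> \<mu>\<^sub>2. x \<in> ?S"
      by (intro AE_tilt[OF sets(1) assms(3) Z1] AE_tilt[OF sets(2) assms(3) Z2] AE_supp_add_measure[OF sets])+
    ultimately have "ennreal \<bar>(\<integral>x. f x \<partial>tilt \<Phi> \<mu>\<^sub>1) - (\<integral>x. f x \<partial>tilt \<Phi> \<mu>\<^sub>2)\<bar>
        \<le> ennreal L * W1 (tilt \<Phi> \<mu>\<^sub>1) (tilt \<Phi> \<mu>\<^sub>2)"
      using t1(1) t2(1) by (intro W1_lipschitz_bound[OF bp(3,4)])
    then show ?thesis
      using mult_left_mono[of _ _ "ennreal z1"] unfolding scale L(1) eq by (simp add: mult.assoc)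
  qed
  show ?thesis
  proof (intro exI[of _ g] conjI impI, unfold f_def[symmetric])
    show "lip_norm UNIV g \<le> 1"
      using lip_norm_le_iff[of 1 UNIV g] g by simp
    show "integrable (tilt \<Phi> \<mu>\<^sub>1) f" "integrable (tilt \<Phi> \<mu>\<^sub>2) f" "integrable \<mu>\<^sub>2 g"
      by (fact t1(1) t2(1) int2)+
    show "W1 \<mu>\<^sub>1 \<mu>\<^sub>2 = partition_fn \<Phi> \<mu>\<^sub>1 * ennreal
        \<bar>(\<integral>x. f x \<partial>tilt \<Phi> \<mu>\<^sub>1) - (\<integral>x. f x \<partial>tilt \<Phi> \<mu>\<^sub>2)
          + (\<integral>x. g x \<partial>\<mu>\<^sub>2) * (1 / enn2real (partition_fn \<Phi> \<mu>\<^sub>2) - 1 / enn2real (partition_fn \<Phi> \<mu>\<^sub>1))\<bar>"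
      unfolding z1_def[symmetric] z2_def[symmetric] unfolding Z1(1) by (fact scale)
    assume "partition_fn \<Phi> \<mu>\<^sub>1 = partition_fn \<Phi> \<mu>\<^sub>2"
    then have "z1 = z2" by (simp add: z1_def z2_def)
    note bound = bound[OF this, folded Z1(1)]
    show "W1 \<mu>\<^sub>1 \<mu>\<^sub>2 \<le> partition_fn \<Phi> \<mu>\<^sub>1 * lip_norm ?S f * W1 (tilt \<Phi> \<mu>\<^sub>1) (tilt \<Phi> \<mu>\<^sub>2)"
      by (fact bound)
    \<comment> \<open>A vanishing seminorm makes the right side 0, and the bound forces the left
      side down to it.\<close>
    show "W1 \<mu>\<^sub>1 \<mu>\<^sub>2 = partition_fn \<Phi> \<mu>\<^sub>1 * lip_norm ?S f * W1 (tilt \<Phi> \<mu>\<^sub>1) (tilt \<Phi> \<mu>\<^sub>2)"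
      if "lip_norm ?S f = 0"
      using bound that by simp
  qed
qed

end
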